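(* Let $R$ be a non-zero ring with identity (not necessarily commutative), let $n\ge 1$, and let $f(Z)=Z^n-a_1Z^{n-1}+\cdots+(-1)^{n-1}a_{n-1}Z+(-1)^na_n\in R[Z]$. Let $I_f$ be the two-sided ideal of $R[X_1,\dots,X_n]$ generated by $\sigma_1-a_1,\dots,\sigma_n-a_n$, where $\sigma_1,\dots,\sigma_n$ are the elementary symmetric polynomials in $X_1,\dots,X_n$, and let $R_f=R[X_1,\dots,X_n]/I_f$. Let $L_f$ be the two-sided ideal of $R$ generated by all commutators $xa_i-a_ix$ with $x\in R$, $1\le i\le n$, let $M_f=I_f\cap R$, and let $T_f=R/L_f$. Then $L_f=M_f$. Moreover, $R_f$ is a free $T_f$-module with basis $r_1^{\alpha_1}\cdots r_n^{\alpha_n}$, where $r_i=X_i+I_f$ and $0\le\alpha_i\le n-i$ for all $1\le i\le n$.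
   Context: In $R[X_1,\dots,X_n]$ the variables commute with each other and with all elements of $R$. $M_f$ is the kernel of the composite map $R\to R[X_1,\dots,X_n]\to R_f$. Since $L_f\subseteq I_f$, the $R$-module structure of $R_f$ induces a $T_f$-module structure on $R_f$. The basis is understood as a family indexed by the tuples $(\alpha_1,\dots,\alpha_n)$; if $L_f=R$ then $T_f$ and $R_f$ are zero and the assertion about the basis is trivial. *)

theory Defs
  imports
    "HOL-Algebra.Algebraic_Closure_Type"
    "HOL-Library.Poly_Mapping"
begin

section \<open>Polynomials in several commuting variables over a noncommutative ring\<close>

text \<open>
  The base ring \<open>R\<close> is a type \<open>'a\<close> of class \<open>ring_1\<close> (nonzero, unital, not necessarily
  commutative); \<open>ring_of_type_algebra\<close> is its incarnation as a record. A polynomial is a finitely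
  supported map from exponent vectors to coefficients, multiplied by convolution
  \<open>(p * q) m = (\<Sum>k + l = m. p k * q l)\<close>, so that the variables commute with each other and with the
  coefficients while the coefficients need not commute. \<open>mpoly_ring n\<close> keeps those
  polynomials whose monomials only involve \<open>X\<^sub>1, \<dots>, X\<^sub>n\<close>.
\<close>

type_synonym 'a mpoly = "(nat \<Rightarrow>\<^sub>0 nat) \<Rightarrow>\<^sub>0 'a"

definition mpoly_ring :: "nat \<Rightarrow> 'a::ring_1 mpoly ring" where
  "mpoly_ring n =
    \<lparr>carrier = {p. \<forall>m\<in>Poly_Mapping.keys p. Poly_Mapping.keys m \<subseteq> {1..n}},
     monoid.mult = (*), one = 1, ring.zero = 0, add = (+)\<rparr>"

definition mconst :: "'a::ring_1 \<Rightarrow> 'a mpoly" where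
  "mconst c = Poly_Mapping.single 0 c"

definition mvar :: "nat \<Rightarrow> 'a::ring_1 mpoly" where
  "mvar i = Poly_Mapping.single (Poly_Mapping.single i 1) 1"

text \<open>
  As the polynomial ring is not commutative, the squarefree monomial \<open>\<Prod>j\<in>S. X\<^sub>j\<close> cannot be written
  with \<open>\<Prod>\<close>; it is given by its exponent vector.
\<close>

definition elem_sym :: "nat \<Rightarrow> nat \<Rightarrow> 'a::ring_1 mpoly" where
  "elem_sym n k =
    (\<Sum>S | S \<subseteq> {1..n} \<and> card S = k. Poly_Mapping.single (\<Sum>j\<in>S. Poly_Mapping.single j 1) 1)"


section \<open>The ideals and quotients attached to \<open>f\<close>\<close>

text \<open>
  \<open>vcoeff f i\<close> is the \<open>a\<^sub>i\<close> in
  \<open>f = Z\<^sup>n - a\<^sub>1 Z\<^sup>n\<^sup>-\<^sup>1 + \<cdots> + (-1)\<^sup>n a\<^sub>n\<close>, see \<open>vcoeff_eq\<close> and \<open>degree_signed_monic\<close> below.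
\<close>

definition vcoeff :: "'a::ring_1 poly \<Rightarrow> nat \<Rightarrow> 'a" where
  "vcoeff f i = (- 1) ^ i * Polynomial.coeff f (Polynomial.degree f - i)"

definition I_ideal :: "'a::ring_1 poly \<Rightarrow> 'a mpoly set" where
  "I_ideal f =
    (let n = Polynomial.degree f
     in genideal (mpoly_ring n) ((\<lambda>i. elem_sym n i - mconst (vcoeff f i)) ` {1..n}))"

definition R_quot :: "'a::ring_1 poly \<Rightarrow> 'a mpoly set ring" where
  "R_quot f = mpoly_ring (Polynomial.degree f) Quot I_ideal f"

definition to_R_quot :: "'a::ring_1 poly \<Rightarrow> 'a mpoly \<Rightarrow> 'a mpoly set" where
  "to_R_quot f p = I_ideal f +>\<^bsub>mpoly_ring (Polynomial.degree f)\<^esub> p"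

definition L_ideal :: "'a::ring_1 poly \<Rightarrow> 'a set" where
  "L_ideal f =
    genideal ring_of_type_algebra
      {x * vcoeff f i - vcoeff f i * x | x i. i \<in> {1..Polynomial.degree f}}"

definition T_quot :: "'a::ring_1 poly \<Rightarrow> 'a set ring" where
  "T_quot f = ring_of_type_algebra Quot L_ideal f"

definition M_ideal :: "'a::ring_1 poly \<Rightarrow> 'a set" where
  "M_ideal f = a_kernel ring_of_type_algebra (R_quot f) (\<lambda>r. to_R_quot f (mconst r))"

text \<open>
  \<open>R_quot f\<close> as a left module over \<open>T_quot f\<close>: a coset \<open>t = r + L\<^sub>f\<close> acts as the image of any of its
  representatives \<open>r\<close>. That the set below is a singleton, so that \<open>the_elem\<close> is meaningful, is
  \<open>R_quot_module_smult\<close>.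
\<close>

definition R_quot_module :: "'a::ring_1 poly \<Rightarrow> ('a set, 'a mpoly set) module" where
  "R_quot_module f =
    \<lparr>carrier = carrier (R_quot f), monoid.mult = monoid.mult (R_quot f), one = one (R_quot f),
     ring.zero = ring.zero (R_quot f), add = add (R_quot f),
     module.smult = (\<lambda>t y. the_elem ((\<lambda>r. to_R_quot f (mconst r) \<otimes>\<^bsub>R_quot f\<^esub> y) ` t))\<rparr>"

text \<open>The ordered product \<open>r\<^sub>1\<^bsup>\<alpha> 1\<^esup> \<cdots> r\<^sub>n\<^bsup>\<alpha> n\<^esup>\<close>.\<close>

definition R_quot_monom :: "'a::ring_1 poly \<Rightarrow> (nat \<Rightarrow> nat) \<Rightarrow> 'a mpoly set" where
  "R_quot_monom f \<alpha> =
    foldr (\<lambda>i y. (to_R_quot f (mvar i) [^]\<^bsub>R_quot f\<^esub> \<alpha> i) \<otimes>\<^bsub>R_quot f\<^esub> y)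
      [1..<Suc (Polynomial.degree f)] \<one>\<^bsub>R_quot f\<^esub>"


section \<open>Free left modules over noncommutative rings\<close>

text \<open>
  The library locale \<open>module\<close> asks for a commutative base ring; this is the same list of axioms over
  an arbitrary ring.
\<close>

locale left_module = R?: ring R + M?: abelian_group M
  for R :: "('a, 'k) ring_scheme" (structure) and M :: "('a, 'b, 'm) module_scheme" (structure) +
  assumes smult_closed:
      "\<lbrakk>a \<in> carrier R; x \<in> carrier M\<rbrakk> \<Longrightarrow> a \<odot>\<^bsub>M\<^esub> x \<in> carrier M"
    and smult_l_distr:
      "\<lbrakk>a \<in> carrier R; b \<in> carrier R; x \<in> carrier M\<rbrakk> \<Longrightarrow>
        (a \<oplus>\<^bsub>R\<^esub> b) \<odot>\<^bsub>M\<^esub> x = a \<odot>\<^bsub>M\<^esub> x \<oplus>\<^bsub>M\<^esub> b \<odot>\<^bsub>M\<^esub> x"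
    and smult_r_distr:
      "\<lbrakk>a \<in> carrier R; x \<in> carrier M; y \<in> carrier M\<rbrakk> \<Longrightarrow>
        a \<odot>\<^bsub>M\<^esub> (x \<oplus>\<^bsub>M\<^esub> y) = a \<odot>\<^bsub>M\<^esub> x \<oplus>\<^bsub>M\<^esub> a \<odot>\<^bsub>M\<^esub> y"
    and smult_assoc1:
      "\<lbrakk>a \<in> carrier R; b \<in> carrier R; x \<in> carrier M\<rbrakk> \<Longrightarrow>
        (a \<otimes>\<^bsub>R\<^esub> b) \<odot>\<^bsub>M\<^esub> x = a \<odot>\<^bsub>M\<^esub> (b \<odot>\<^bsub>M\<^esub> x)"
    and smult_one:
      "x \<in> carrier M \<Longrightarrow> \<one>\<^bsub>R\<^esub> \<odot>\<^bsub>M\<^esub> x = x"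

text \<open>
  \<open>R\<close>-module \<open>M\<close>, free on the family \<open>(b \<alpha>)\<^bsub>\<alpha> \<in> A\<^esub>\<close>. Independence is that of the family: a repetition
  \<open>b \<alpha> = b \<beta>\<close> with \<open>\<alpha> \<noteq> \<beta>\<close> is a dependence unless \<open>R\<close> is the zero ring.
\<close>

definition free_left_module_on ::
    "('a, 'k) ring_scheme \<Rightarrow> ('a, 'b, 'm) module_scheme \<Rightarrow> 'i set \<Rightarrow> ('i \<Rightarrow> 'b) \<Rightarrow> bool" where
  "free_left_module_on R M A b \<longleftrightarrow>
    left_module R M \<and>
    b \<in> A \<rightarrow> carrier M \<and>
    (\<forall>x\<in>carrier M. \<exists>F c. finite F \<and> F \<subseteq> A \<and> c \<in> F \<rightarrow> carrier R \<and>
       x = (\<Oplus>\<^bsub>M\<^esub>\<alpha>\<in>F. c \<alpha> \<odot>\<^bsub>M\<^esub> b \<alpha>)) \<and>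
    (\<forall>F c. finite F \<and> F \<subseteq> A \<and> c \<in> F \<rightarrow> carrier R \<and>
       (\<Oplus>\<^bsub>M\<^esub>\<alpha>\<in>F. c \<alpha> \<odot>\<^bsub>M\<^esub> b \<alpha>) = \<zero>\<^bsub>M\<^esub> \<longrightarrow> (\<forall>\<alpha>\<in>F. c \<alpha> = \<zero>\<^bsub>R\<^esub>))"


section \<open>Well-definedness\<close>

lemma signed_monic_coeff:
  fixes a :: "nat \<Rightarrow> 'a::ring_1"
  defines "f \<equiv> \<lambda>n. Polynomial.monom 1 n + (\<Sum>i=1..n. Polynomial.monom ((- 1) ^ i * a i) (n - i))"
  shows "Polynomial.coeff (f n) j =
    (if j = n then 1 else if j < n then (- 1) ^ (n - j) * a (n - j) else 0)"
proof -
  have "(\<Sum>i=1..n. Polynomial.coeff (Polynomial.monom ((- 1) ^ i * a i) (n - i)) j)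
      = (\<Sum>i=1..n. if i = n - j \<and> j < n then (- 1) ^ i * a i else 0)"
    by (rule sum.cong) auto
  also have "\<dots> = (if j < n then (- 1) ^ (n - j) * a (n - j) else 0)"
    by (cases "j < n") (auto simp: sum.delta')
  finally show ?thesis
    by (auto simp: f_def coeff_sum)
qed

lemma degree_signed_monic:
  fixes a :: "nat \<Rightarrow> 'a::ring_1"
  assumes "f = Polynomial.monom 1 n + (\<Sum>i=1..n. Polynomial.monom ((- 1) ^ i * a i) (n - i))"
  shows "Polynomial.degree f = n"
proof (rule antisym)
  show "Polynomial.degree f \<le> n"
    unfolding assms by (intro degree_le allI impI) (unfold signed_monic_coeff, simp)
  show "n \<le> Polynomial.degree f"
    unfolding assms by (intro le_degree) (unfold signed_monic_coeff, simp)
qed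

lemma vcoeff_eq:
  fixes a :: "nat \<Rightarrow> 'a::ring_1"
  assumes f: "f = Polynomial.monom 1 n + (\<Sum>i=1..n. Polynomial.monom ((- 1) ^ i * a i) (n - i))"
    and i: "i \<in> {1..n}"
  shows "vcoeff f i = a i"
proof -
  have "Polynomial.coeff f (n - i) = (- 1) ^ i * a i"
    using i unfolding f signed_monic_coeff by auto
  then show ?thesis
    unfolding vcoeff_def degree_signed_monic[OF f]
    by (simp flip: mult.assoc power_add add: mult_2[symmetric])
qed

lemma ring_of_type_algebra_ring: "ring (ring_of_type_algebra :: 'a::ring_1 ring)"
proof -
  have "\<exists>y. x + y = 0" for x :: 'a
    using add.right_inverse by blast
  then show ?thesis
    unfolding ring_of_type_algebra_def
    by unfold_locales (auto simp: algebra_simps Units_def)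
qed

lemma mpoly_ring_ring: "ring (mpoly_ring n :: 'a::ring_1 mpoly ring)"
proof -
  have add: "x + y \<in> carrier (mpoly_ring n)"
    if "x \<in> carrier (mpoly_ring n)" "y \<in> carrier (mpoly_ring n)" for x y :: "'a mpoly"
    using that Poly_Mapping.keys_add[of x y] by (auto simp: mpoly_ring_def)
  have mult: "x * y \<in> carrier (mpoly_ring n)"
    if "x \<in> carrier (mpoly_ring n)" "y \<in> carrier (mpoly_ring n)" for x y :: "'a mpoly"
  proof -
    have "Poly_Mapping.keys m \<subseteq> {1..n}" if m_in: "m \<in> Poly_Mapping.keys (x * y)" for m
    proof -
      obtain k l where m: "m = k + l" and "k \<in> Poly_Mapping.keys x" "l \<in> Poly_Mapping.keys y"
        using m_in keys_mult[of x y] by blast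
      then have "Poly_Mapping.keys k \<subseteq> {1..n}" "Poly_Mapping.keys l \<subseteq> {1..n}"
        using \<open>x \<in> _\<close> \<open>y \<in> _\<close> by (auto simp: mpoly_ring_def)
      then show ?thesis
        using Poly_Mapping.keys_add[of k l] unfolding m by blast
    qed
    then show ?thesis by (simp add: mpoly_ring_def)
  qed
  have one: "(1 :: 'a mpoly) \<in> carrier (mpoly_ring n)"
    by (simp add: mpoly_ring_def flip: single_one)
  have uminus: "\<exists>y\<in>carrier (mpoly_ring n). y \<oplus>\<^bsub>mpoly_ring n\<^esub> x = \<zero>\<^bsub>mpoly_ring n\<^esub>"
    if "x \<in> carrier (mpoly_ring n)" for x :: "'a mpoly"
    using that by (intro bexI[of _ "- x"]) (auto simp: mpoly_ring_def)
  show ?thesis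
  proof (rule ringI)
    show "abelian_group (mpoly_ring n :: 'a mpoly ring)"
    proof (rule abelian_groupI)
      show "\<zero>\<^bsub>mpoly_ring n\<^esub> \<in> carrier (mpoly_ring n :: 'a mpoly ring)"
        by (simp add: mpoly_ring_def)
      show "x \<oplus>\<^bsub>mpoly_ring n\<^esub> y \<in> carrier (mpoly_ring n)"
        if "x \<in> carrier (mpoly_ring n)" "y \<in> carrier (mpoly_ring n)" for x y :: "'a mpoly"
        using add[OF that] by (simp add: mpoly_ring_def)
    qed (fact uminus | simp add: mpoly_ring_def add_ac)+
    show "Group.monoid (mpoly_ring n :: 'a mpoly ring)"
    proof (rule monoidI)
      show "x \<otimes>\<^bsub>mpoly_ring n\<^esub> y \<in> carrier (mpoly_ring n)"
        if "x \<in> carrier (mpoly_ring n)" "y \<in> carrier (mpoly_ring n)" for x y :: "'a mpoly"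
        using mult[OF that] by (simp add: mpoly_ring_def)
      show "\<one>\<^bsub>mpoly_ring n\<^esub> \<in> carrier (mpoly_ring n :: 'a mpoly ring)"
        using one by (simp add: mpoly_ring_def)
    qed (simp_all add: mpoly_ring_def mult.assoc)
  qed (auto simp: mpoly_ring_def algebra_simps)
qed

lemma mconst_carrier: "mconst c \<in> carrier (mpoly_ring n)"
  by (auto simp: mconst_def mpoly_ring_def)

lemma elem_sym_carrier: "(elem_sym n k :: 'a::ring_1 mpoly) \<in> carrier (mpoly_ring n)"
proof -
  have "Poly_Mapping.keys m \<subseteq> {1..n}"
    if m: "m \<in> Poly_Mapping.keys (elem_sym n k :: 'a mpoly)" for m
  proof -
    obtain S where S: "S \<subseteq> {1..n}" and
      "m \<in> Poly_Mapping.keys (Poly_Mapping.single (\<Sum>j\<in>S. Poly_Mapping.single j (1::nat)) (1::'a))"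
      using m keys_sum[of "\<lambda>S. Poly_Mapping.single (\<Sum>j\<in>S. Poly_Mapping.single j (1::nat)) (1::'a)"
          "{S. S \<subseteq> {1..n} \<and> card S = k}"]
      unfolding elem_sym_def by blast
    then have "m = (\<Sum>j\<in>S. Poly_Mapping.single j 1)" by simp
    then have "Poly_Mapping.keys m \<subseteq> (\<Union>j\<in>S. Poly_Mapping.keys (Poly_Mapping.single j (1::nat)))"
      using keys_sum[of "\<lambda>j. Poly_Mapping.single j (1::nat)" S] by simp
    then show ?thesis using S by auto
  qed
  then show ?thesis by (simp add: mpoly_ring_def)
qed

lemma elem_sym_commute: "mconst c * elem_sym n k = elem_sym n k * (mconst c :: 'a::ring_1 mpoly)"
  by (simp add: mconst_def elem_sym_def sum_distrib_left sum_distrib_right mult_single)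

lemma minus_mpoly_ring:
  assumes "x \<in> carrier (mpoly_ring n)" "y \<in> carrier (mpoly_ring n)"
  shows "x \<ominus>\<^bsub>mpoly_ring n\<^esub> y = x - (y :: 'a::ring_1 mpoly)"
proof -
  interpret P: ring "mpoly_ring n :: 'a mpoly ring" by (rule mpoly_ring_ring)
  have "- y \<in> carrier (mpoly_ring n)" using assms by (simp add: mpoly_ring_def)
  moreover have "y + (- y) = 0" by simp
  ultimately have "\<ominus>\<^bsub>mpoly_ring n\<^esub> y = - y"
    using P.minus_equality[of "- y" y] assms by (simp add: mpoly_ring_def)
  then show ?thesis by (simp add: a_minus_def) (simp add: mpoly_ring_def)
qed

lemma I_generators_carrier:
  "(\<lambda>i. elem_sym n i - mconst (c i)) ` {1..n} \<subseteq> carrier (mpoly_ring n)"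
proof -
  interpret P: ring "mpoly_ring n :: 'a mpoly ring" by (rule mpoly_ring_ring)
  show ?thesis
    using P.minus_closed[OF elem_sym_carrier mconst_carrier]
    by (auto simp: minus_mpoly_ring elem_sym_carrier mconst_carrier)
qed

lemma I_ideal_ideal: "ideal (I_ideal f) (mpoly_ring (Polynomial.degree f))"
  unfolding I_ideal_def Let_def
  by (intro ring.genideal_ideal mpoly_ring_ring I_generators_carrier)

lemma mconst_hom: "mconst \<in> ring_hom ring_of_type_algebra (mpoly_ring n)"
  by (rule ring_hom_memI)
    (auto simp: mconst_carrier, auto simp: mconst_def mpoly_ring_def ring_of_type_algebra_def
      mult_single single_add)

lemma to_R_quot_mconst_hom:
  "ring_hom_ring ring_of_type_algebra (R_quot f) (\<lambda>r. to_R_quot f (mconst r))"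
proof -
  interpret I: ideal "I_ideal f" "mpoly_ring (Polynomial.degree f)" by (rule I_ideal_ideal)
  have "to_R_quot f \<circ> mconst \<in> ring_hom ring_of_type_algebra (R_quot f)"
    unfolding R_quot_def
    using I.rcos_ring_hom by (intro ring_hom_trans[OF mconst_hom]) (simp add: to_R_quot_def[abs_def])
  moreover have "ring (R_quot f)"
    unfolding R_quot_def by (rule I.quotient_is_ring)
  ultimately show ?thesis
    by (intro ring_hom_ringI2 ring_of_type_algebra_ring) (simp_all add: comp_def)
qed

lemma L_ideal_ideal: "ideal (L_ideal f) ring_of_type_algebra"
  unfolding L_ideal_def
  by (intro ring.genideal_ideal ring_of_type_algebra_ring) (auto simp: ring_of_type_algebra_def)

lemma L_ideal_subset_M_ideal: "L_ideal f \<subseteq> M_ideal f"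
proof -
  let ?n = "Polynomial.degree f" and ?a = "vcoeff f"
  interpret P: ring "mpoly_ring ?n :: 'a mpoly ring" by (rule mpoly_ring_ring)
  interpret I: ideal "I_ideal f" "mpoly_ring ?n" by (rule I_ideal_ideal)
  interpret h: ring_hom_ring ring_of_type_algebra "R_quot f" "\<lambda>r. to_R_quot f (mconst r)"
    by (rule to_R_quot_mconst_hom)
  have M: "x \<in> M_ideal f" if "mconst x \<in> I_ideal f" for x
    using that I.a_rcos_const[of "mconst x"]
    by (simp add: M_ideal_def a_kernel_def' to_R_quot_def R_quot_def FactRing_def
        ring_of_type_algebra_def)
  have comm: "mconst (x * ?a i - ?a i * x) \<in> I_ideal f" if i: "i \<in> {1..?n}" for x i
  proof -
    define g where "g = elem_sym ?n i - mconst (?a i)"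
    have g: "g \<in> I_ideal f"
      unfolding I_ideal_def Let_def g_def
      using P.genideal_self[OF I_generators_carrier] i by blast
    have mult: "p \<otimes>\<^bsub>mpoly_ring ?n\<^esub> q = p * q" for p q :: "'a mpoly"
      by (simp add: mpoly_ring_def)
    have gx: "g * mconst x \<in> I_ideal f" and xg: "mconst x * g \<in> I_ideal f"
      using I.I_l_closed[OF g mconst_carrier] I.I_r_closed[OF g mconst_carrier]
      by (simp_all add: mult)
    have "g * mconst x - mconst x * g \<in> I_ideal f"
      using I.a_closed[OF gx I.a_inv_closed[OF xg]]
      unfolding minus_mpoly_ring[OF I.a_Hcarr[OF gx] I.a_Hcarr[OF xg], symmetric] a_minus_def .
    also have "g * mconst x - mconst x * g = mconst x * mconst (?a i) - mconst (?a i) * mconst x"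
      unfolding g_def by (simp add: algebra_simps elem_sym_commute)
    also have "\<dots> = mconst (x * ?a i - ?a i * x)"
      by (simp add: mconst_def mult_single single_diff)
    finally show ?thesis .
  qed
  have "ideal (M_ideal f) ring_of_type_algebra"
    unfolding M_ideal_def by (rule h.kernel_is_ideal)
  then show ?thesis
    unfolding L_ideal_def
    by (intro ring.genideal_minimal ring_of_type_algebra_ring) (use comm M in blast)+
qed

lemma R_quot_module_smult:
  "(L_ideal f +>\<^bsub>ring_of_type_algebra\<^esub> r) \<odot>\<^bsub>R_quot_module f\<^esub> y =
    to_R_quot f (mconst r) \<otimes>\<^bsub>R_quot f\<^esub> y"
proof -
  interpret L: ideal "L_ideal f" ring_of_type_algebra by (rule L_ideal_ideal)
  interpret h: ring_hom_ring ring_of_type_algebra "R_quot f" "\<lambda>r. to_R_quot f (mconst r)"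
    by (rule to_R_quot_mconst_hom)
  have carr: "x \<in> carrier ring_of_type_algebra" for x :: 'a
    by (simp add: ring_of_type_algebra_def)
  have eq: "to_R_quot f (mconst s) = to_R_quot f (mconst r)"
    if s: "s \<in> L_ideal f +>\<^bsub>ring_of_type_algebra\<^esub> r" for s
  proof -
    obtain l where l: "l \<in> L_ideal f" and s: "s = l \<oplus>\<^bsub>ring_of_type_algebra\<^esub> r"
      using s by (auto simp: a_r_coset_def')
    have "to_R_quot f (mconst l) = \<zero>\<^bsub>R_quot f\<^esub>"
      using subsetD[OF L_ideal_subset_M_ideal l] unfolding M_ideal_def a_kernel_def' by blast
    then show ?thesis
      unfolding s h.hom_add[OF carr carr] using h.hom_closed[OF carr] by simp
  qed
  let ?act = "\<lambda>s. to_R_quot f (mconst s) \<otimes>\<^bsub>R_quot f\<^esub> y"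
  have r: "r \<in> L_ideal f +>\<^bsub>ring_of_type_algebra\<^esub> r"
    using carr by (rule L.a_rcos_self)
  have "?act ` (L_ideal f +>\<^bsub>ring_of_type_algebra\<^esub> r) \<subseteq> {?act r}"
    using eq by (metis (no_types, lifting) image_subsetI singletonI)
  then have "?act ` (L_ideal f +>\<^bsub>ring_of_type_algebra\<^esub> r) = {?act r}"
    using r by blast
  then show ?thesis
    by (simp add: R_quot_module_def)
qed

end

theory Submission
  imports Defs
begin

text \<open>
  Divide \<open>f\<close> successively by \<open>Z - X\<^sub>1, \<dots>, Z - X\<^sub>n\<close>. The \<open>k\<close>-th remainder \<open>g\<^sub>k\<close> only involves
  \<open>X\<^sub>1, \<dots>, X\<^sub>k\<close> and is monic of degree \<open>n - k + 1\<close> in \<open>X\<^sub>k\<close>. All the \<open>g\<^sub>k\<close> vanish exactly when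
  \<open>f = (Z - X\<^sub>1) \<cdots> (Z - X\<^sub>n)\<close>, so \<open>I\<^sub>f\<close> is also generated by the \<open>g\<^sub>k\<close>. Dividing by
  \<open>g\<^sub>n, \<dots>, g\<^sub>1\<close> in turn reduces every polynomial to a combination of the \<open>X\<^sup>\<alpha>\<close> with \<open>\<alpha>\<^sub>i \<le> n - i\<close>.
  Conversely the \<open>g\<^sub>k\<close> are central modulo \<open>L\<^sub>f\<close> and, as in a Groebner basis with
  coprime leading monomials, a reduced polynomial in their ideal has all its coefficients in \<open>L\<^sub>f\<close>.
  The constant polynomials are the case \<open>M\<^sub>f \<subseteq> L\<^sub>f\<close>.
\<close>

section \<open>Expansion of polynomials into monomials\<close>

lemma poly_mapping_sum_single:
  "(\<Sum>m\<in>Poly_Mapping.keys p. Poly_Mapping.single m (Poly_Mapping.lookup p m)) = p"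
  by (rule poly_mapping_eqI)
    (auto simp: lookup_sum lookup_single when_def sum.delta in_keys_iff)

text \<open>The coefficients keep the order of the factors while exponents add commutatively, so a
  commutator of polynomials is governed by commutators of their coefficients.\<close>

lemma poly_mapping_mult_expand:
  fixes p q :: "'a::ring_1 mpoly"
  shows "p * q = (\<Sum>u\<in>Poly_Mapping.keys p. \<Sum>v\<in>Poly_Mapping.keys q.
    Poly_Mapping.single (u + v) (Poly_Mapping.lookup p u * Poly_Mapping.lookup q v))"
proof -
  have "p * q = (\<Sum>u\<in>Poly_Mapping.keys p. Poly_Mapping.single u (Poly_Mapping.lookup p u)) *
    (\<Sum>v\<in>Poly_Mapping.keys q. Poly_Mapping.single v (Poly_Mapping.lookup q v))"
    by (simp only: poly_mapping_sum_single)
  then show ?thesis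
    by (simp add: sum_distrib_left sum_distrib_right mult_single) (rule sum.swap)
qed

lemma sum_in_set:
  assumes "0 \<in> S" "\<And>x y. x \<in> S \<Longrightarrow> y \<in> S \<Longrightarrow> x + y \<in> S" "\<And>i. i \<in> A \<Longrightarrow> f i \<in> S"
  shows "sum f A \<in> S"
  using assms(3) by (induction A rule: infinite_finite_induct) (auto intro: assms(1,2))

lemma mvar_commute: "mvar k * p = p * (mvar k :: 'a::ring_1 mpoly)"
  unfolding mvar_def poly_mapping_mult_expand[of p] poly_mapping_mult_expand[of _ p]
  by (simp add: add.commute)


section \<open>Symmetric polynomials of a finite set of variables\<close>

text \<open>Arbitrary variable sets are allowed because variables are removed one at a time. For
  finite \<open>A\<close> this is, up to the sign (-1)^k, the coefficient of Z^(card A - k) in the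
  product of all Z - X_j with j in \<open>A\<close>.\<close>

definition esym_on :: "nat set \<Rightarrow> nat \<Rightarrow> 'a::ring_1 mpoly" where
  "esym_on A k =
    (\<Sum>S | S \<subseteq> A \<and> card S = k. Poly_Mapping.single (\<Sum>j\<in>S. Poly_Mapping.single j 1) 1)"

lemma elem_sym_eq_esym_on: "elem_sym n = esym_on {1..n}"
  by (simp add: fun_eq_iff elem_sym_def esym_on_def)

lemma esym_on_0: "finite A \<Longrightarrow> esym_on A 0 = 1"
proof -
  assume "finite A"
  then have "{S. S \<subseteq> A \<and> card S = 0} = {{}}"
    by (auto dest: finite_subset)
  then show ?thesis by (simp add: esym_on_def)
qed

lemma esym_on_eq_0:
  assumes "finite A" "card A < k"
  shows "esym_on A k = 0"
proof -
  have "{S. S \<subseteq> A \<and> card S = k} = {}"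
    using assms by (auto dest: card_mono)
  then show ?thesis unfolding esym_on_def by (simp only: sum.empty)
qed

lemma esym_on_insert:
  assumes "finite A" "x \<notin> A"
  shows "esym_on (insert x A) (Suc k) = esym_on A (Suc k) + mvar x * esym_on A k"
proof -
  let ?P = "\<lambda>A k. {S. S \<subseteq> A \<and> card S = k}"
  let ?s = "\<lambda>S. Poly_Mapping.single (\<Sum>j\<in>S. Poly_Mapping.single j (1::nat)) (1::'a)"
  have fin: "finite S" if "S \<in> ?P A k" for S k
    using that assms finite_subset by blast
  \<comment> \<open>Sort the subsets of size k + 1 by whether they contain \<open>x\<close>.\<close>
  have split: "?P (insert x A) (Suc k) = ?P A (Suc k) \<union> insert x ` ?P A k"
  proof (intro equalityI subsetI)
    fix S assume S: "S \<in> ?P (insert x A) (Suc k)"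
    show "S \<in> ?P A (Suc k) \<union> insert x ` ?P A k"
    proof (cases "x \<in> S")
      case True
      then have "S = insert x (S - {x})" by auto
      moreover have "S - {x} \<in> ?P A k"
        using S True assms by (auto simp: card_Diff_singleton)
      ultimately show ?thesis by blast
    qed (use S in auto)
  next
    fix S assume "S \<in> ?P A (Suc k) \<union> insert x ` ?P A k"
    then show "S \<in> ?P (insert x A) (Suc k)"
    proof
      assume "S \<in> insert x ` ?P A k"
      then obtain S' where "S = insert x S'" and S': "S' \<in> ?P A k" by auto
      moreover have "x \<notin> S'" using S' assms by blast
      ultimately show ?thesis using fin[OF S'] by auto
    qed auto
  qed
  have "inj_on (insert x) (?P A k)"
    using assms by (intro inj_onI) (metis (no_types, lifting) insert_ident mem_Collect_eq subset_iff)
  moreover have "?s (insert x S) = mvar x * ?s S" if "S \<in> ?P A k" for S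
  proof -
    have "x \<notin> S" using that assms by auto
    then show ?thesis using fin[OF that] by (simp add: mvar_def mult_single)
  qed
  moreover have "finite (?P A k)" for k
    using assms by (intro finite_subset[OF _ finite_Pow_iff[THEN iffD2, OF assms(1)]]) auto
  moreover have "?P A (Suc k) \<inter> insert x ` ?P A k = {}"
    using assms by auto
  ultimately have "sum ?s (?P A (Suc k) \<union> insert x ` ?P A k) =
      sum ?s (?P A (Suc k)) + (\<Sum>S\<in>?P A k. mvar x * ?s S)"
    by (simp add: sum.union_disjoint sum.reindex)
  then show ?thesis
    unfolding esym_on_def split sum_distrib_left .
qed


section \<open>The coefficients of the successive quotients of \<open>f\<close>\<close>

text \<open>
  Dividing \<open>Z\<^sup>n + b 1 Z\<^sup>n\<^sup>-\<^sup>1 + \<cdots> + b n\<close> successively by \<open>Z - X\<^sub>1, \<dots>, Z - X\<^sub>k\<close> and dropping the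
  remainders gives a quotient of degree \<open>n - k\<close> in which \<open>hcoef b k i\<close> is the coefficient of
  \<open>Z\<^sup>n\<^sup>-\<^sup>k\<^sup>-\<^sup>i\<close>; the \<open>k\<close>-th remainder is \<open>hcoef b k (n - k + 1)\<close>.
\<close>

fun hcoef :: "(nat \<Rightarrow> 'a::ring_1) \<Rightarrow> nat \<Rightarrow> nat \<Rightarrow> 'a mpoly" where
  "hcoef b 0 i = mconst (b i)"
| "hcoef b (Suc k) 0 = hcoef b k 0"
| "hcoef b (Suc k) (Suc i) = hcoef b k (Suc i) + mvar (Suc k) * hcoef b (Suc k) i"

text \<open>Split the factor Z - X_{k+1} off the product over j > k and solve for the coefficients
  of the remaining product: this is the recursion that defines \<open>hcoef\<close>.\<close>

lemma esym_on_recursion: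
  assumes "k < n"
  shows "(- 1) ^ Suc i * esym_on {Suc (Suc k)..n} (Suc i) =
    (- 1) ^ Suc i * esym_on {Suc k..n} (Suc i) +
    mvar (Suc k) * ((- 1) ^ i * (esym_on {Suc (Suc k)..n} i :: 'a::ring_1 mpoly))"
proof -
  have "{Suc k..n} = insert (Suc k) {Suc (Suc k)..n}"
    using assms by auto
  moreover have "mvar (Suc k) * ((- 1) ^ i * p) = (- 1) ^ i * (mvar (Suc k) * p)" for p :: "'a mpoly"
    by (simp add: mvar_commute mult.assoc)
  ultimately show ?thesis
    by (simp add: esym_on_insert algebra_simps)
qed

text \<open>
  Both sides express \<open>f = (Z - X\<^sub>1) \<cdots> (Z - X\<^sub>n)\<close> modulo \<open>S\<close>: the right one says that all the
  remainders vanish. The difference of \<open>hcoef b k i\<close> and the corresponding coefficient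
  of \<open>(Z - X\<^sub>k\<^sub>+\<^sub>1) \<cdots> (Z - X\<^sub>n)\<close> satisfies the recursion of \<open>hcoef\<close>, which can be run in both directions.
\<close>

lemma elem_sym_relations_iff_remainders:
  fixes S :: "'a::ring_1 mpoly set"
  assumes zero: "0 \<in> S"
    and diff: "\<And>x y. x \<in> S \<Longrightarrow> y \<in> S \<Longrightarrow> x - y \<in> S"
    and mvar: "\<And>k x. k \<in> {1..n} \<Longrightarrow> x \<in> S \<Longrightarrow> mvar k * x \<in> S"
    and b0: "b 0 = 1" and b: "\<And>i. i > n \<Longrightarrow> b i = 0"
  shows "(\<forall>i\<in>{1..n}. elem_sym n i - mconst ((- 1) ^ i * b i) \<in> S) \<longleftrightarrow>
    (\<forall>k\<in>{1..n}. hcoef b k (Suc (n - k)) \<in> S)"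
proof -
  define \<delta> where "\<delta> k i = hcoef b k i - (- 1) ^ i * esym_on {Suc k..n} i" for k i
  have neg: "- x \<in> S \<longleftrightarrow> x \<in> S" for x
    using diff[OF zero, of x] diff[OF zero, of "- x"] by auto
  have add: "x + y \<in> S" if "x \<in> S" "y \<in> S" for x y
    using diff[of x "- y"] that neg by simp
  have sgn: "(- 1) ^ i * x \<in> S \<longleftrightarrow> x \<in> S" for i x
    by (cases "even i") (simp_all add: neg)
  have b0': "hcoef b k 0 = 1" for k
    by (induction k) (simp_all add: b0 mconst_def)
  have \<delta>0: "\<delta> k 0 = 0" for k
    by (simp add: \<delta>_def b0' esym_on_0)
  have \<delta>Suc: "\<delta> (Suc k) (Suc i) = \<delta> k (Suc i) + mvar (Suc k) * \<delta> (Suc k) i" if "k < n" for k i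
    unfolding \<delta>_def hcoef.simps esym_on_recursion[OF that] by (simp add: algebra_simps)
  \<comment> \<open>Only n - k variables are left in \<open>{Suc k..n}\<close>, so their elementary
    symmetric polynomial of index n - k + 1 vanishes.\<close>
  have rem: "hcoef b k (Suc (n - k)) = \<delta> k (Suc (n - k))" if "k \<in> {1..n}" for k
    using that by (simp add: \<delta>_def esym_on_eq_0)
  have \<delta>_large: "\<delta> 0 i = 0" if "i > n" for i
    using that by (simp add: \<delta>_def esym_on_eq_0 b mconst_def)
  \<comment> \<open>Up to sign, row 0 of \<open>\<delta>\<close> consists of the relations between
    the elementary symmetric polynomials and the coefficients.\<close>
  have "(elem_sym n i - mconst ((- 1) ^ i * b i) \<in> S) \<longleftrightarrow> \<delta> 0 i \<in> S" for i
  proof -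
    have "mconst ((- 1) ^ i * c) = (- 1) ^ i * (mconst c :: 'a mpoly)" for c
      by (cases "even i") (simp_all add: mconst_def single_uminus)
    then have "(- 1) ^ i * (elem_sym n i - mconst ((- 1) ^ i * b i)) = - \<delta> 0 i"
      by (cases "even i") (simp_all add: \<delta>_def elem_sym_eq_esym_on)
    then show ?thesis using sgn neg by metis
  qed
  moreover have "(\<forall>i\<in>{1..n}. \<delta> 0 i \<in> S) \<longleftrightarrow> (\<forall>k\<in>{1..n}. \<delta> k (Suc (n - k)) \<in> S)"
  proof
    assume *: "\<forall>i\<in>{1..n}. \<delta> 0 i \<in> S"
    have "\<delta> k i \<in> S" if "k \<le> n" for k i
      using that
    proof (induction k arbitrary: i)
      case 0
      show ?case
        using * \<delta>0 \<delta>_large zero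
        by (metis One_nat_def Suc_leI atLeastAtMost_iff linorder_not_less neq0_conv)
    next
      case (Suc k)
      note outer = Suc.IH and le = Suc.prems
      show ?case
      proof (induction i)
        case (Suc i)
        then show ?case
          using le by (auto simp: \<delta>Suc intro!: add mvar outer)
      qed (simp add: \<delta>0 zero)
    qed
    then show "\<forall>k\<in>{1..n}. \<delta> k (Suc (n - k)) \<in> S" by auto
  next
    assume *: "\<forall>k\<in>{1..n}. \<delta> k (Suc (n - k)) \<in> S"
    \<comment> \<open>First the entries beyond the degree n - k: in each row the remainder is the
      lowest of them, and the recursion climbs from it with the help of the previous row.\<close>
    have upper: "\<delta> k i \<in> S" if "k \<le> n" "n - k < i" for k i
      using that
    proof (induction k arbitrary: i)
      case 0
      then show ?case by (simp add: \<delta>_large zero)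
    next
      case (Suc k)
      have "Suc (n - Suc k) \<le> i" using Suc.prems by simp
      then show ?case
      proof (induction i rule: dec_induct)
        case base
        then show ?case using * Suc.prems by auto
      next
        case (step i)
        then show ?case
          using Suc.prems by (auto simp: \<delta>Suc intro!: add mvar Suc.IH)
      qed
    qed
    \<comment> \<open>Row n is now entirely in \<open>S\<close>; solving the recursion for the
      earlier row leads back to row 0.\<close>
    have "\<delta> (n - j) i \<in> S" if "j \<le> n" for i j
      using that
    proof (induction j arbitrary: i)
      case 0
      then show ?case using upper[of n i] zero \<delta>0 by (cases i) auto
    next
      case (Suc j)
      then have j: "n - j = Suc (n - Suc j)" by simp
      show ?case
      proof (cases i)
        case (Suc i')
        have "\<delta> (n - Suc j) (Suc i') = \<delta> (n - j) (Suc i') - mvar (n - j) * \<delta> (n - j) i'"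
          using \<delta>Suc[of "n - Suc j" i'] Suc.prems by (simp add: j)
        then show ?thesis
          using Suc.IH Suc.prems Suc by (auto intro!: diff mvar)
      qed (simp add: \<delta>0 zero)
    qed
    from this[of n] show "\<forall>i\<in>{1..n}. \<delta> 0 i \<in> S" by simp
  qed
  ultimately show ?thesis using rem by simp
qed


section \<open>Division by a monic polynomial in one of the variables\<close>

text \<open>Bounds on the degree in one variable and restrictions on the variables are both
  expressed by a set of admissible exponents.\<close>

definition supp_in :: "(nat \<Rightarrow>\<^sub>0 nat) set \<Rightarrow> 'a::ring_1 mpoly set" where
  "supp_in W = {p. Poly_Mapping.keys p \<subseteq> W}"

lemma supp_in_0: "0 \<in> supp_in W"
  by (simp add: supp_in_def)

lemma supp_in_add: "p \<in> supp_in W \<Longrightarrow> q \<in> supp_in W \<Longrightarrow> p + q \<in> supp_in W"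
  using Poly_Mapping.keys_add[of p q] by (auto simp: supp_in_def)

lemma supp_in_diff: "p \<in> supp_in W \<Longrightarrow> q \<in> supp_in W \<Longrightarrow> p - q \<in> supp_in W"
  using Poly_Mapping.keys_diff[of p q] by (auto simp: supp_in_def)

lemma supp_in_single: "m \<in> W \<Longrightarrow> Poly_Mapping.single m c \<in> supp_in W"
  by (simp add: supp_in_def)

lemma supp_in_mono: "p \<in> supp_in V \<Longrightarrow> V \<subseteq> W \<Longrightarrow> p \<in> supp_in W"
  by (auto simp: supp_in_def)

lemma supp_in_mult:
  assumes "p \<in> supp_in U" "q \<in> supp_in V" "\<And>u v. u \<in> U \<Longrightarrow> v \<in> V \<Longrightarrow> u + v \<in> W"
  shows "p * q \<in> supp_in W"
  using assms keys_mult[of p q] by (fastforce simp: supp_in_def)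

lemma lookup_eq_0_if_supp_in: "p \<in> supp_in W \<Longrightarrow> m \<notin> W \<Longrightarrow> Poly_Mapping.lookup p m = 0"
  by (auto simp: supp_in_def in_keys_iff)

lemma supp_in_sum_singles:
  assumes "p \<in> supp_in W" "0 \<in> S" "\<And>x y. x \<in> S \<Longrightarrow> y \<in> S \<Longrightarrow> x + y \<in> S"
    and "\<And>m c. m \<in> W \<Longrightarrow> Poly_Mapping.single m c \<in> S"
  shows "p \<in> S"
  using sum_in_set[OF assms(2,3), of "Poly_Mapping.keys p"
      "\<lambda>m. Poly_Mapping.single m (Poly_Mapping.lookup p m)"] assms(1,4)
  by (auto simp: poly_mapping_sum_single supp_in_def)

lemma lookup_mult_monomial:
  "Poly_Mapping.lookup (p * Poly_Mapping.single d 1) (m + d) = Poly_Mapping.lookup (p :: 'a::ring_1 mpoly) m"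
proof -
  have "p * Poly_Mapping.single d 1 =
      (\<Sum>u\<in>Poly_Mapping.keys p. Poly_Mapping.single (u + d) (Poly_Mapping.lookup p u))"
    by (subst poly_mapping_mult_expand) simp
  then show ?thesis
    by (auto simp: lookup_sum lookup_single when_def sum.delta in_keys_iff)
qed

lemma monomial_factor:
  assumes "d \<le> Poly_Mapping.lookup m k"
  obtains m' where "m = m' + Poly_Mapping.single k (d::nat)"
proof
  show "m = (m - Poly_Mapping.single k d) + Poly_Mapping.single k d"
    using assms by (intro poly_mapping_eqI) (auto simp: lookup_add lookup_minus lookup_single when_def)
qed

text \<open>As g is monic in X_k, no coefficient is inverted, and the quotient can stand on the left
  over any ring. \<open>H\<close> contains the exponents of the lower terms; the conditions on
  \<open>W\<close> say that removing X_k^d, or replacing it by a lower term, never leaves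
  \<open>W\<close>.\<close>

lemma monic_division:
  fixes g :: "'a::ring_1 mpoly"
  assumes g: "g - Poly_Mapping.single (Poly_Mapping.single k d) 1 \<in> supp_in H"
    and H: "\<And>l. l \<in> H \<Longrightarrow> Poly_Mapping.lookup l k < d"
    and W: "\<And>m. m + Poly_Mapping.single k d \<in> W \<Longrightarrow> m \<in> W"
      "\<And>m l. m + Poly_Mapping.single k d \<in> W \<Longrightarrow> l \<in> H \<Longrightarrow> m + l \<in> W"
    and p: "p \<in> supp_in W"
  obtains q where "q \<in> supp_in W" "p - q * g \<in> supp_in {m \<in> W. Poly_Mapping.lookup m k < d}"
proof -
  let ?W = "{m \<in> W. Poly_Mapping.lookup m k < d}"
  \<comment> \<open>\<open>Q\<close> collects the polynomials that admit division with remainder. It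
    is additively closed, so single terms suffice, by induction on their exponent of X_k.\<close>
  define Q where "Q = {p. \<exists>q\<in>supp_in W. p - q * g \<in> supp_in ?W}"
  have QI: "p \<in> Q" if "q \<in> supp_in W" "p - q * g \<in> supp_in ?W" for p q
    using that by (auto simp: Q_def)
  have zero: "0 \<in> Q"
    by (rule QI[of 0]) (simp_all add: supp_in_0)
  have add: "x + y \<in> Q" if xy: "x \<in> Q" "y \<in> Q" for x y
  proof -
    obtain q r where "q \<in> supp_in W" "x - q * g \<in> supp_in ?W"
      "r \<in> supp_in W" "y - r * g \<in> supp_in ?W"
      using xy by (auto simp: Q_def)
    moreover have "x + y - (q + r) * g = (x - q * g) + (y - r * g)"
      by (simp add: algebra_simps)
    ultimately show ?thesis
      by (intro QI[of "q + r"]) (simp_all only: supp_in_add)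
  qed
  have single: "Poly_Mapping.single m c \<in> Q" if "m \<in> W" for m c
    using that
  proof (induction "Poly_Mapping.lookup m k" arbitrary: m c rule: less_induct)
    case less
    show ?case
    proof (cases "Poly_Mapping.lookup m k < d")
      case True
      then show ?thesis
        using less.prems by (intro QI[of 0]) (simp_all add: supp_in_0 supp_in_single)
    next
      case False
      then obtain m' where m: "m = m' + Poly_Mapping.single k d"
        using monomial_factor by (metis linorder_not_less)
      \<comment> \<open>With g = X_k^d + \<open>?h\<close> the term equals
        \<open>?q * g - ?q * ?h\<close>, and all exponents of X_k in \<open>?q * ?h\<close> are
        smaller than in the term.\<close>
      let ?q = "Poly_Mapping.single m' c" and ?h = "g - Poly_Mapping.single (Poly_Mapping.single k d) 1"
      have "?q * ?h \<in> supp_in {l \<in> W. Poly_Mapping.lookup l k < Poly_Mapping.lookup m k}"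
      proof (rule supp_in_mult[OF supp_in_single[of m' "{m'}"] g])
        fix u l assume u: "u \<in> {m'}" and l: "l \<in> H"
        have "m' + l \<in> W" using W(2) less.prems l unfolding m by blast
        then show "u + l \<in> {l \<in> W. Poly_Mapping.lookup l k < Poly_Mapping.lookup m k}"
          using H[OF l] u by (simp add: m lookup_add)
      qed simp
      then have "0 - ?q * ?h \<in> supp_in {l \<in> W. Poly_Mapping.lookup l k < Poly_Mapping.lookup m k}"
        by (intro supp_in_diff supp_in_0)
      then have "0 - ?q * ?h \<in> Q"
      proof (rule supp_in_sum_singles[OF _ zero add])
        fix l c
        assume "l \<in> {l \<in> W. Poly_Mapping.lookup l k < Poly_Mapping.lookup m k}"
        then show "Poly_Mapping.single l c \<in> Q"
          by (intro less.hyps) simp_all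
      qed
      moreover have "?q * g \<in> Q"
        using W(1) less.prems unfolding m
        by (intro QI[of ?q]) (simp_all add: supp_in_0 supp_in_single)
      moreover have "Poly_Mapping.single m c = ?q * g + (0 - ?q * ?h)"
        by (simp add: m algebra_simps mult_single)
      ultimately show ?thesis by (simp only: add)
    qed
  qed
  have "p \<in> Q"
    using p by (rule supp_in_sum_singles[OF _ zero add single])
  then show ?thesis using that by (auto simp: Q_def)
qed

section \<open>The remainders as monic divisors\<close>

lemma hcoef_supp_in: "hcoef b k i \<in> supp_in {m. Poly_Mapping.keys m \<subseteq> {1..k}}"
proof (induction b k i rule: hcoef.induct)
  case (1 b i)
  then show ?case by (simp add: mconst_def supp_in_single)
next
  case (2 b k)
  then show ?case by (auto elim!: supp_in_mono)
next
  case (3 b k i)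
  have "mvar (Suc k) * hcoef b (Suc k) i \<in> supp_in {m. Poly_Mapping.keys m \<subseteq> {1..Suc k}}"
    unfolding mvar_def
    by (rule supp_in_mult[OF supp_in_single[of _ "{Poly_Mapping.single (Suc k) 1}"] 3(2)])
      (use Poly_Mapping.keys_add in \<open>fastforce+\<close>)
  moreover have "hcoef b k (Suc i) \<in> supp_in {m. Poly_Mapping.keys m \<subseteq> {1..Suc k}}"
    using 3(1) by (auto elim!: supp_in_mono)
  ultimately show ?case by (simp add: supp_in_add)
qed

text \<open>Along row k + 1 the recursion multiplies by X_{k+1} and adds an entry of row k, which is
  free of X_{k+1}; so the top power of X_{k+1} keeps the coefficient 1.\<close>

lemma hcoef_monic:
  assumes "b 0 = 1"
  shows "hcoef b (Suc k) i - Poly_Mapping.single (Poly_Mapping.single (Suc k) i) 1 \<in>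
    supp_in {m. Poly_Mapping.keys m \<subseteq> {1..Suc k} \<and> Poly_Mapping.lookup m (Suc k) < i}"
    (is "_ \<in> supp_in (?H i)")
proof (induction i)
  case 0
  have "hcoef b k 0 = 1" for k
    by (induction k) (simp_all add: assms mconst_def)
  then show ?case
    by (simp add: supp_in_0 del: hcoef.simps(1))
next
  case (Suc i)
  let ?X = "\<lambda>i. Poly_Mapping.single (Poly_Mapping.single (Suc k) i) 1"
  have "hcoef b k (Suc i) \<in> supp_in (?H (Suc i))"
  proof (rule supp_in_mono[OF hcoef_supp_in], safe)
    fix m :: "nat \<Rightarrow>\<^sub>0 nat"
    assume m: "Poly_Mapping.keys m \<subseteq> {1..k}"
    then have "Suc k \<notin> Poly_Mapping.keys m" by auto
    then show "Poly_Mapping.lookup m (Suc k) < Suc i" by (simp add: in_keys_iff)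
    show "x \<in> {1..Suc k}" if "x \<in> Poly_Mapping.keys m" for x
      using m that by auto
  qed
  moreover have "mvar (Suc k) * (hcoef b (Suc k) i - ?X i) \<in> supp_in (?H (Suc i))"
    unfolding mvar_def
    by (rule supp_in_mult[OF supp_in_single[of _ "{Poly_Mapping.single (Suc k) 1}"] Suc.IH])
      (use Poly_Mapping.keys_add in \<open>fastforce simp: lookup_add\<close>)+
  have "mvar (Suc k) * ?X i = ?X (Suc i)"
    by (simp add: mvar_def mult_single flip: single_add)
  from \<open>hcoef b k (Suc i) \<in> _\<close> and \<open>mvar (Suc k) * (hcoef b (Suc k) i - ?X i) \<in> _\<close>
  have "hcoef b k (Suc i) + mvar (Suc k) * (hcoef b (Suc k) i - ?X i) \<in> supp_in (?H (Suc i))"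
    by (simp only: supp_in_add)
  moreover have "hcoef b (Suc k) (Suc i) - ?X (Suc i) =
      hcoef b k (Suc i) + mvar (Suc k) * (hcoef b (Suc k) i - ?X i)"
    unfolding \<open>_ = ?X (Suc i)\<close>[symmetric] by (simp add: right_diff_distrib)
  ultimately show ?case by (simp only:)
qed


lemma remainder_monic:
  assumes "b 0 = 1" "k \<in> {1..n}"
  shows "hcoef b k (Suc (n - k)) - Poly_Mapping.single (Poly_Mapping.single k (Suc (n - k))) 1 \<in>
    supp_in {m. Poly_Mapping.keys m \<subseteq> {1..k} \<and> Poly_Mapping.lookup m k < Suc (n - k)}"
  using hcoef_monic[where b = b, OF assms(1), of "k - 1" "Suc (n - k)"] assms by (cases k) simp_all

text \<open>The exponents still possible after dividing by g_n, ..., g_{k+1}: \<open>box n n\<close>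
  bounds no exponent, and \<open>box n 0\<close> is the exponent set of the claimed basis.\<close>

definition box :: "nat \<Rightarrow> nat \<Rightarrow> (nat \<Rightarrow>\<^sub>0 nat) set" where
  "box n k = {m. Poly_Mapping.keys m \<subseteq> {1..n} \<and> (\<forall>j\<in>{Suc k..n}. Poly_Mapping.lookup m j < Suc (n - j))}"

text \<open>The division runs from g_n down to g_1: since g_k is free of X_{k+1}, ..., X_n, dividing
  by it preserves the bounds already achieved for these variables.\<close>

lemma reduce_modulo_remainders:
  fixes I :: "'a::ring_1 mpoly set"
  assumes b0: "b 0 = 1"
    and zero: "0 \<in> I"
    and add: "\<And>x y. x \<in> I \<Longrightarrow> y \<in> I \<Longrightarrow> x + y \<in> I"
    and l_mult: "\<And>x q. x \<in> I \<Longrightarrow> q \<in> supp_in {m. Poly_Mapping.keys m \<subseteq> {1..n}} \<Longrightarrow> q * x \<in> I"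
    and rem: "\<And>k. k \<in> {1..n} \<Longrightarrow> hcoef b k (Suc (n - k)) \<in> I"
    and p: "p \<in> supp_in {m. Poly_Mapping.keys m \<subseteq> {1..n}}"
  obtains r where "r \<in> supp_in (box n 0)" "p - r \<in> I"
proof -
  have "\<exists>r\<in>supp_in (box n (n - j)). p - r \<in> I" if "j \<le> n" for j
    using that
  proof (induction j)
    case 0
    then show ?case
      using p zero by (intro bexI[of _ p]) (auto simp: box_def)
  next
    case (Suc j)
    define k where "k = n - j"
    have k: "k \<in> {1..n}" and n_Suc_j: "n - Suc j = k - 1"
      using Suc.prems by (auto simp: k_def)
    obtain r where r: "r \<in> supp_in (box n k)" "p - r \<in> I"
      using Suc k_def by auto
    obtain q where q: "q \<in> supp_in (box n k)"
      "r - q * hcoef b k (Suc (n - k)) \<in> supp_in {m \<in> box n k. Poly_Mapping.lookup m k < Suc (n - k)}"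
    proof (rule monic_division[OF remainder_monic[where b = b, OF b0 k] _ _ _ r(1)])
      fix m l :: "nat \<Rightarrow>\<^sub>0 nat"
      assume "m + Poly_Mapping.single k (Suc (n - k)) \<in> box n k"
      then show m: "m \<in> box n k"
        by (auto simp: box_def lookup_add lookup_single when_def in_keys_iff subset_iff split: if_splits)
      assume l: "l \<in> {m. Poly_Mapping.keys m \<subseteq> {1..k} \<and> Poly_Mapping.lookup m k < Suc (n - k)}"
      have "Poly_Mapping.lookup l j = 0" if "j \<in> {Suc k..n}" for j
      proof -
        have "j \<notin> Poly_Mapping.keys l" using l that by auto
        then show ?thesis by (simp add: in_keys_iff)
      qed
      moreover have "Poly_Mapping.keys (m + l) \<subseteq> {1..n}"
      proof -
        have "Poly_Mapping.keys l \<subseteq> {1..n}" "Poly_Mapping.keys m \<subseteq> {1..n}"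
          using m l k by (auto simp: box_def)
        then show ?thesis using Poly_Mapping.keys_add[of m l] by blast
      qed
      ultimately show "m + l \<in> box n k"
        using m by (simp add: box_def lookup_add)
    qed auto
    have "{m \<in> box n k. Poly_Mapping.lookup m k < Suc (n - k)} \<subseteq> box n (k - 1)"
    proof
      fix m assume m: "m \<in> {m \<in> box n k. Poly_Mapping.lookup m k < Suc (n - k)}"
      have "Poly_Mapping.lookup m j < Suc (n - j)" if "j \<in> {k..n}" for j
        using that m by (cases "j = k") (auto simp: box_def)
      then show "m \<in> box n (k - 1)"
        using m k by (simp add: box_def)
    qed
    then have "r - q * hcoef b k (Suc (n - k)) \<in> supp_in (box n (k - 1))"
      using q(2) supp_in_mono by blast
    moreover have "q * hcoef b k (Suc (n - k)) \<in> I"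
      using q(1) by (intro l_mult rem k) (auto elim!: supp_in_mono simp: box_def)
    then have "(p - r) + q * hcoef b k (Suc (n - k)) \<in> I"
      by (rule add[OF r(2)])
    then have "p - (r - q * hcoef b k (Suc (n - k))) \<in> I"
      by (simp add: algebra_simps)
    ultimately show ?case unfolding n_Suc_j by blast
  qed
  from this[of n] show ?thesis using that by auto
qed


section \<open>Independence modulo an ideal of coefficients\<close>

text \<open>For an ideal \<open>L\<close> this is the kernel of reducing coefficients modulo
  \<open>L\<close>; computations over R/L are carried out as congruences modulo this set.\<close>

definition coeffs_in :: "'a::ring_1 set \<Rightarrow> 'a mpoly set" where
  "coeffs_in L = {p. \<forall>m. Poly_Mapping.lookup p m \<in> L}"

text \<open>A two-sided ideal, described elementwise, modulo which all \<open>b i\<close> are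
  central; \<open>b0\<close> makes the remainders monic. The instance in view is L_f with the signed
  coefficients of f.\<close>

locale central_modulo =
  fixes L :: "'a::ring_1 set" and b :: "nat \<Rightarrow> 'a" and n :: nat
  assumes zero: "0 \<in> L"
    and diff: "x \<in> L \<Longrightarrow> y \<in> L \<Longrightarrow> x - y \<in> L"
    and l_mult: "x \<in> L \<Longrightarrow> r * x \<in> L"
    and r_mult: "x \<in> L \<Longrightarrow> x * r \<in> L"
    and comm: "r * b i - b i * r \<in> L"
    and b0: "b 0 = 1"
begin

lemma add: "x \<in> L \<Longrightarrow> y \<in> L \<Longrightarrow> x + y \<in> L"
  using diff[of x "0 - y"] diff[OF zero, of y] by simp

lemma uminus: "x \<in> L \<Longrightarrow> - x \<in> L"
  using diff[OF zero, of x] by simp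

lemma coeffs_in_0: "0 \<in> coeffs_in L"
  by (simp add: coeffs_in_def zero)

lemma coeffs_in_add: "p \<in> coeffs_in L \<Longrightarrow> q \<in> coeffs_in L \<Longrightarrow> p + q \<in> coeffs_in L"
  by (simp add: coeffs_in_def lookup_add add)

lemma coeffs_in_diff: "p \<in> coeffs_in L \<Longrightarrow> q \<in> coeffs_in L \<Longrightarrow> p - q \<in> coeffs_in L"
  by (simp add: coeffs_in_def lookup_minus diff)

lemma coeffs_in_single: "c \<in> L \<Longrightarrow> Poly_Mapping.single m c \<in> coeffs_in L"
  by (simp add: coeffs_in_def lookup_single when_def zero)

lemma coeffs_in_mult:
  assumes "p \<in> coeffs_in L \<or> q \<in> coeffs_in L"
  shows "p * q \<in> coeffs_in L"
proof -
  have "Poly_Mapping.lookup p u * Poly_Mapping.lookup q v \<in> L" for u v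
    using assms by (auto simp: coeffs_in_def l_mult r_mult)
  then show ?thesis
    unfolding poly_mapping_mult_expand[of p q]
    by (intro sum_in_set coeffs_in_0 coeffs_in_add coeffs_in_single)
qed

text \<open>For constants this comes from \<open>comm\<close>; it passes through the recursion
  because the variables commute with every polynomial.\<close>

lemma hcoef_central: "p * hcoef b k i - hcoef b k i * p \<in> coeffs_in L"
proof (induction k arbitrary: i)
  case 0
  have "p * mconst (b i) - mconst (b i) * p = (\<Sum>u\<in>Poly_Mapping.keys p.
      Poly_Mapping.single u (Poly_Mapping.lookup p u * b i - b i * Poly_Mapping.lookup p u))"
    unfolding poly_mapping_mult_expand[of p] poly_mapping_mult_expand[of _ p] mconst_def
    by (simp add: single_diff sum_subtractf)
  moreover have "\<dots> \<in> coeffs_in L"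
    by (intro sum_in_set coeffs_in_0 coeffs_in_add coeffs_in_single comm)
  ultimately show ?case by simp
next
  case (Suc k)
  note outer = Suc.IH
  show ?case
  proof (induction i)
    case 0
    then show ?case by (simp add: outer)
  next
    case (Suc i)
    let ?X = "mvar (Suc k) :: 'a mpoly" and ?h = "hcoef b (Suc k) i" and ?h' = "hcoef b k (Suc i)"
    have "p * (?X * ?h) = ?X * (p * ?h)"
      by (simp add: mvar_commute[of "Suc k" p] flip: mult.assoc)
    then have "p * (?h' + ?X * ?h) - (?h' + ?X * ?h) * p = (p * ?h' - ?h' * p) + ?X * (p * ?h - ?h * p)"
      by (simp add: algebra_simps)
    then show ?case
      using coeffs_in_add[OF outer coeffs_in_mult[OF disjI2[OF Suc.IH]]] by simp
  qed
qed

text \<open>Multiplying by a monic polynomial adds degrees in X_k even modulo \<open>L\<close>: a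
  coefficient of q outside \<open>L\<close> with the largest X_k-exponent would reappear modulo
  \<open>L\<close> in \<open>q * g\<close>, at an X_k-exponent of at least d.\<close>

lemma monic_factor_coeffs_in:
  assumes g: "g - Poly_Mapping.single (Poly_Mapping.single k d) 1 \<in> supp_in H"
    and H: "\<And>l. l \<in> H \<Longrightarrow> Poly_Mapping.lookup l k < d"
    and high: "\<And>m. d \<le> Poly_Mapping.lookup m k \<Longrightarrow> Poly_Mapping.lookup (q * g) m \<in> L"
  shows "q \<in> coeffs_in L"
proof (rule ccontr)
  let ?X = "Poly_Mapping.single (Poly_Mapping.single k d) (1 :: 'a)"
  let ?restr = "\<lambda>A. \<Sum>m\<in>A. Poly_Mapping.single m (Poly_Mapping.lookup q m)"
  define B where "B = {m. Poly_Mapping.lookup q m \<notin> L}"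
  assume "q \<notin> coeffs_in L"
  then have "B \<noteq> {}" by (auto simp: B_def coeffs_in_def)
  have B_keys: "B \<subseteq> Poly_Mapping.keys q"
    using zero by (auto simp: B_def in_keys_iff)
  then have "finite B" by (rule finite_subset) simp
  \<comment> \<open>\<open>e\<close> is the degree of q in X_k modulo \<open>L\<close>, attained at
    the exponent \<open>m\<close> below.\<close>
  define e where "e = Max ((\<lambda>m. Poly_Mapping.lookup m k) ` B)"
  have "e \<in> (\<lambda>m. Poly_Mapping.lookup m k) ` B"
    unfolding e_def using \<open>finite B\<close> \<open>B \<noteq> {}\<close> by (intro Max_in) auto
  then obtain m where m: "m \<in> B" "Poly_Mapping.lookup m k = e" by auto
  have e: "Poly_Mapping.lookup u k \<le> e" if "u \<in> B" for u
    unfolding e_def using \<open>finite B\<close> that by simp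
  define q1 where "q1 = ?restr B"
  define q2 where "q2 = ?restr (Poly_Mapping.keys q - B)"
  have q: "q = q1 + q2"
    using sum.subset_diff[OF B_keys, of "\<lambda>m. Poly_Mapping.single m (Poly_Mapping.lookup q m)"]
    unfolding q1_def q2_def poly_mapping_sum_single by (simp only: finite_keys add.commute)
  have "q2 \<in> coeffs_in L"
    unfolding q2_def by (intro sum_in_set coeffs_in_0 coeffs_in_add coeffs_in_single) (auto simp: B_def)
  then have "q2 * g \<in> coeffs_in L" by (simp add: coeffs_in_mult)
  have "q1 \<in> supp_in B"
    unfolding q1_def by (intro sum_in_set supp_in_0 supp_in_add supp_in_single)
  \<comment> \<open>The lower terms of g cannot reach the X_k-exponent e + d, so from
    \<open>q1 * g\<close> only the leading term of g contributes there.\<close>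
  then have "q1 * (g - ?X) \<in> supp_in {u. Poly_Mapping.lookup u k < e + d}"
    by (rule supp_in_mult[OF _ g]) (auto simp: lookup_add intro!: add_le_less_mono e H)
  then have "Poly_Mapping.lookup (q1 * (g - ?X)) (m + Poly_Mapping.single k d) = 0"
    by (rule lookup_eq_0_if_supp_in) (simp add: lookup_add m)
  moreover have "Poly_Mapping.lookup (q1 * ?X) (m + Poly_Mapping.single k d) = Poly_Mapping.lookup q m"
    unfolding lookup_mult_monomial q1_def
    using \<open>finite B\<close> m by (simp add: lookup_sum lookup_single when_def sum.delta)
  moreover have "q * g = q1 * (g - ?X) + q1 * ?X + q2 * g"
    by (simp add: q algebra_simps)
  ultimately have "Poly_Mapping.lookup q m = Poly_Mapping.lookup (q * g) (m + Poly_Mapping.single k d)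
      - Poly_Mapping.lookup (q2 * g) (m + Poly_Mapping.single k d)"
    by (simp add: lookup_add)
  also have "\<dots> \<in> L"
    using \<open>q2 * g \<in> coeffs_in L\<close> by (intro diff high) (auto simp: lookup_add coeffs_in_def)
  finally show False using m by (simp add: B_def)
qed

section \<open>The ideal of the remainders modulo \<open>L\<close>\<close>

abbreviation remainder :: "nat \<Rightarrow> 'a mpoly" where
  "remainder k \<equiv> hcoef b k (Suc (n - k))"

text \<open>Cofactors stand only on the left and one remainder is adjoined at a time, so that
  membership can be analysed by induction on \<open>k\<close>. Centrality modulo \<open>L\<close>
  makes the result two-sided.\<close>

fun rem_ideal :: "nat \<Rightarrow> 'a mpoly set" where
  "rem_ideal 0 = coeffs_in L"
| "rem_ideal (Suc k) = {x + q * remainder (Suc k) | x q. x \<in> rem_ideal k}"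

lemma rem_ideal_mono: "rem_ideal k \<subseteq> rem_ideal (Suc k)"
proof
  fix x assume "x \<in> rem_ideal k"
  moreover have "x = x + 0 * remainder (Suc k)" by simp
  ultimately show "x \<in> rem_ideal (Suc k)" unfolding rem_ideal.simps by blast
qed

lemma coeffs_in_rem_ideal: "coeffs_in L \<subseteq> rem_ideal k"
  by (induction k) (use rem_ideal_mono in \<open>auto simp del: rem_ideal.simps(2)\<close>)

lemma rem_ideal_0: "0 \<in> rem_ideal k"
  using coeffs_in_rem_ideal coeffs_in_0 by blast

lemma rem_ideal_diff: "x \<in> rem_ideal k \<Longrightarrow> y \<in> rem_ideal k \<Longrightarrow> x - y \<in> rem_ideal k"
proof (induction k arbitrary: x y)
  case (Suc k)
  then obtain x' q y' r where *: "x = x' + q * remainder (Suc k)" "y = y' + r * remainder (Suc k)"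
    "x' \<in> rem_ideal k" "y' \<in> rem_ideal k"
    by auto
  have "x - y = (x' - y') + (q - r) * remainder (Suc k)"
    by (simp add: * algebra_simps)
  then show ?case using Suc.IH[OF *(3,4)] by (auto simp del: hcoef.simps)
qed (simp add: coeffs_in_diff)

lemma rem_ideal_add: "x \<in> rem_ideal k \<Longrightarrow> y \<in> rem_ideal k \<Longrightarrow> x + y \<in> rem_ideal k"
  using rem_ideal_diff[of x k "0 - y"] rem_ideal_diff[OF rem_ideal_0, of y] by simp

lemma rem_ideal_l_mult: "x \<in> rem_ideal k \<Longrightarrow> p * x \<in> rem_ideal k"
proof (induction k arbitrary: x)
  case (Suc k)
  then obtain x' q where *: "x = x' + q * remainder (Suc k)" "x' \<in> rem_ideal k"
    by auto
  have "p * x = p * x' + (p * q) * remainder (Suc k)"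
    by (simp add: * algebra_simps)
  then show ?case using Suc.IH[OF *(2)] by (auto simp del: hcoef.simps)
qed (simp add: coeffs_in_mult)

text \<open>A right factor moves past the remainder at the cost of a multiple of their commutator,
  which has its coefficients in \<open>L\<close>.\<close>

lemma rem_ideal_r_mult: "x \<in> rem_ideal k \<Longrightarrow> x * p \<in> rem_ideal k"
proof (induction k arbitrary: x)
  case (Suc k)
  then obtain x' q where *: "x = x' + q * remainder (Suc k)" "x' \<in> rem_ideal k"
    by auto
  let ?g = "remainder (Suc k)"
  have "q * (p * ?g - ?g * p) \<in> coeffs_in L"
    using coeffs_in_mult hcoef_central by blast
  then have "x' * p - q * (p * ?g - ?g * p) \<in> rem_ideal k"
    using Suc.IH[OF *(2)] rem_ideal_diff coeffs_in_rem_ideal by blast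
  moreover have "x * p = (x' * p - q * (p * ?g - ?g * p)) + (q * p) * ?g"
    by (simp add: * algebra_simps)
  ultimately show ?case by (auto simp del: hcoef.simps)
qed (simp add: coeffs_in_mult)

lemma remainder_in_rem_ideal: "k \<in> {1..n} \<Longrightarrow> remainder k \<in> rem_ideal n"
proof -
  assume k: "k \<in> {1..n}"
  then obtain k' where k': "k = Suc k'" by (cases k) auto
  have "remainder k = 0 + 1 * remainder (Suc k')"
    by (simp add: k')
  then have "remainder k \<in> rem_ideal k"
    unfolding k' rem_ideal.simps using rem_ideal_0 by blast
  moreover have "rem_ideal k \<subseteq> rem_ideal n"
    using k lift_Suc_mono_le[of rem_ideal] rem_ideal_mono by auto
  ultimately show ?thesis by blast
qed

text \<open>
  Members of \<open>rem_ideal j\<close> can be reduced modulo a later remainder without leaving \<open>rem_ideal j\<close>, since the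
  coefficients of the earlier remainders may be reduced instead.
\<close>

lemma rem_ideal_reduce:
  assumes "x \<in> rem_ideal j" "k \<in> {1..n}" "j < k"
  obtains x' q l where "x = x' + q * remainder k + l" "x' \<in> rem_ideal j" "l \<in> coeffs_in L"
    "x' \<in> supp_in {m. Poly_Mapping.lookup m k < Suc (n - k)}"
proof -
  let ?W = "{m. Poly_Mapping.lookup m k < Suc (n - k)}"
  have "\<exists>x' q l. x = x' + q * remainder k + l \<and> x' \<in> rem_ideal j \<and> l \<in> coeffs_in L \<and> x' \<in> supp_in ?W"
    using assms(1,3)
  proof (induction j arbitrary: x)
    case 0
    then show ?case
      by (intro exI[of _ 0] exI[of _ x]) (simp add: supp_in_0 coeffs_in_0)
  next
    case (Suc j)
    let ?g = "remainder k" and ?h = "remainder (Suc j)"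
    obtain y q where x: "x = y + q * ?h" and "y \<in> rem_ideal j"
      using Suc.prems by auto
    then obtain y' q1 l where y: "y = y' + q1 * ?g + l" "y' \<in> rem_ideal j" "l \<in> coeffs_in L" "y' \<in> supp_in ?W"
      using Suc.IH Suc.prems by (metis Suc_lessD)
    \<comment> \<open>The cofactor \<open>q\<close> is reduced modulo \<open>?g\<close> rather than
      the product \<open>q * ?h\<close>, so that what is left is still a multiple of
      \<open>?h\<close>.\<close>
    obtain q2 where "q - q2 * ?g \<in> supp_in ?W"
      using monic_division[OF remainder_monic[where b = b, OF b0 assms(2)], of UNIV q] by (auto simp: supp_in_def)
    define r where "r = q - q2 * ?g"
    have r: "r \<in> supp_in ?W" unfolding r_def by fact
    \<comment> \<open>\<open>?h\<close> is free of X_k because j + 1 < k.\<close>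
    have "r * ?h \<in> supp_in ?W"
    proof (rule supp_in_mult[OF r hcoef_supp_in])
      fix u v :: "nat \<Rightarrow>\<^sub>0 nat" assume "u \<in> ?W" "v \<in> {m. Poly_Mapping.keys m \<subseteq> {1..Suc j}}"
      moreover from this have "k \<notin> Poly_Mapping.keys v" using Suc.prems by auto
      ultimately show "u + v \<in> ?W" by (simp add: lookup_add in_keys_iff)
    qed
    then have "y' + r * ?h \<in> supp_in ?W"
      using y by (simp only: supp_in_add)
    moreover have "y' + r * ?h \<in> rem_ideal (Suc j)"
      using y(2) unfolding rem_ideal.simps by blast
    \<comment> \<open>Turning \<open>q2 * ?g * ?h\<close> into a left multiple of \<open>?g\<close>
      leaves a commutator, absorbed here.\<close>
    moreover have "l + q2 * (?g * ?h - ?h * ?g) \<in> coeffs_in L"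
      using y hcoef_central by (intro coeffs_in_add coeffs_in_mult disjI2)
    moreover have "x = (y' + r * ?h) + (q1 + q2 * ?h) * ?g + (l + q2 * (?g * ?h - ?h * ?g))"
      unfolding x y(1) r_def by (simp add: algebra_simps del: hcoef.simps)
    ultimately show ?case by blast
  qed
  then show ?thesis using that by blast
qed

text \<open>Peel off the last remainder. Once the other part is reduced in X_k, the multiple of g_k
  has, modulo \<open>L\<close>, smaller X_k-degree than g_k itself, so its cofactor vanishes modulo
  \<open>L\<close> and p lies in the preceding ideal.\<close>

lemma reduced_in_rem_ideal_coeffs_in:
  assumes "p \<in> rem_ideal k" "k \<le> n"
    and "\<And>j. j \<in> {1..k} \<Longrightarrow> p \<in> supp_in {m. Poly_Mapping.lookup m j < Suc (n - j)}"
  shows "p \<in> coeffs_in L"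
  using assms
proof (induction k)
  case (Suc k)
  let ?k = "Suc k" and ?g = "remainder (Suc k)"
  let ?W = "{m. Poly_Mapping.lookup m ?k < Suc (n - ?k)}"
  have k: "?k \<in> {1..n}" using Suc.prems by simp
  obtain x q where p: "p = x + q * ?g" "x \<in> rem_ideal k" using Suc.prems by auto
  obtain x' q' l where x: "x = x' + q' * ?g + l" "x' \<in> rem_ideal k" "l \<in> coeffs_in L" "x' \<in> supp_in ?W"
    using rem_ideal_reduce[OF p(2) k] by blast
  have "p - x' \<in> supp_in ?W" using Suc.prems(3)[of ?k] x(4) by (intro supp_in_diff) simp_all
  moreover have eq: "(q + q') * ?g = (p - x') - l" by (simp add: p x algebra_simps)
  ultimately have "Poly_Mapping.lookup ((q + q') * ?g) m \<in> L" if "Suc (n - ?k) \<le> Poly_Mapping.lookup m ?k" for m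
    unfolding eq lookup_minus[of "p - x'"]
    using that x(3) by (subst lookup_eq_0_if_supp_in[of _ ?W]) (auto intro!: uminus simp: coeffs_in_def)
  then have "q + q' \<in> coeffs_in L"
    by (rule monic_factor_coeffs_in[OF remainder_monic[where b = b, OF b0 k], rotated]) auto
  then have "(q + q') * ?g + l \<in> coeffs_in L"
    by (rule coeffs_in_add[OF coeffs_in_mult[OF disjI1] x(3)])
  then have "x' + ((q + q') * ?g + l) \<in> rem_ideal k"
    using x coeffs_in_rem_ideal rem_ideal_add by blast
  moreover have "p = x' + ((q + q') * ?g + l)" unfolding eq by simp
  ultimately have "p \<in> rem_ideal k" by simp
  then show ?case using Suc.prems by (intro Suc.IH) auto
qed simp

end


section \<open>The quotient ring\<close>

lemma carrier_mpoly_ring: "carrier (mpoly_ring n) = supp_in {m. Poly_Mapping.keys m \<subseteq> {1..n}}"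
  by (auto simp: mpoly_ring_def supp_in_def)

lemma mpoly_ring_simps:
  "p \<otimes>\<^bsub>mpoly_ring n\<^esub> q = p * q" "p \<oplus>\<^bsub>mpoly_ring n\<^esub> q = p + q" "\<one>\<^bsub>mpoly_ring n\<^esub> = 1" "\<zero>\<^bsub>mpoly_ring n\<^esub> = 0"
  by (simp_all add: mpoly_ring_def)

lemma to_R_quot_hom:
  "ring_hom_ring (mpoly_ring (Polynomial.degree f)) (R_quot f) (to_R_quot f)"
proof -
  interpret I: ideal "I_ideal f" "mpoly_ring (Polynomial.degree f)" by (rule I_ideal_ideal)
  show ?thesis
    using I.rcos_ring_hom I.quotient_is_ring mpoly_ring_ring
    unfolding R_quot_def to_R_quot_def[abs_def]
    by (intro ring_hom_ringI2)
qed

lemma to_R_quot_surj: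
  assumes "x \<in> carrier (R_quot f)"
  obtains p where "p \<in> carrier (mpoly_ring (Polynomial.degree f))" "x = to_R_quot f p"
  using assms by (auto simp: R_quot_def FactRing_def A_RCOSETS_def' to_R_quot_def)

lemma to_R_quot_eq_zero:
  assumes "p \<in> carrier (mpoly_ring (Polynomial.degree f))"
  shows "to_R_quot f p = \<zero>\<^bsub>R_quot f\<^esub> \<longleftrightarrow> p \<in> I_ideal f"
proof -
  interpret I: ideal "I_ideal f" "mpoly_ring (Polynomial.degree f)" by (rule I_ideal_ideal)
  show ?thesis
    using I.a_rcos_const[of p] I.a_rcos_self[OF assms]
    by (auto simp: to_R_quot_def R_quot_def FactRing_def)
qed

lemma to_R_quot_cong:
  assumes "p \<in> carrier (mpoly_ring (Polynomial.degree f))" "q \<in> carrier (mpoly_ring (Polynomial.degree f))"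
    and "p - q \<in> I_ideal f"
  shows "to_R_quot f p = to_R_quot f q"
proof -
  interpret h: ring_hom_ring "mpoly_ring (Polynomial.degree f)" "R_quot f" "to_R_quot f"
    by (rule to_R_quot_hom)
  have pq: "p - q \<in> carrier (mpoly_ring (Polynomial.degree f))"
    using assms by (simp add: carrier_mpoly_ring supp_in_diff)
  have "to_R_quot f (p - q) = \<zero>\<^bsub>R_quot f\<^esub>"
    using to_R_quot_eq_zero[OF pq] assms by simp
  moreover have "to_R_quot f ((p - q) \<oplus>\<^bsub>mpoly_ring (Polynomial.degree f)\<^esub> q) =
      to_R_quot f (p - q) \<oplus>\<^bsub>R_quot f\<^esub> to_R_quot f q"
    using pq assms by (intro h.hom_add)
  ultimately show ?thesis
    using h.hom_closed[OF assms(2)] by (simp add: mpoly_ring_simps)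
qed

section \<open>Exponent tuples and monomials\<close>

definition exponent :: "nat \<Rightarrow> (nat \<Rightarrow> nat) \<Rightarrow> (nat \<Rightarrow>\<^sub>0 nat)" where
  "exponent n \<alpha> = (\<Sum>i\<in>{1..n}. Poly_Mapping.single i (\<alpha> i))"

lemma lookup_exponent: "Poly_Mapping.lookup (exponent n \<alpha>) i = (if i \<in> {1..n} then \<alpha> i else 0)"
  by (simp add: exponent_def lookup_sum lookup_single when_def)

lemma keys_exponent: "Poly_Mapping.keys (exponent n \<alpha>) \<subseteq> {1..n}"
  by (auto simp: in_keys_iff lookup_exponent split: if_splits)

lemma single_exponent_carrier: "Poly_Mapping.single (exponent n \<alpha>) c \<in> carrier (mpoly_ring n)"
  unfolding carrier_mpoly_ring using keys_exponent by (intro supp_in_single) blast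

text \<open>\<open>exponent n\<close> ignores values outside {1..n}; injectivity comes from the
  tuples being extensional functions, hence \<open>undefined\<close> there.\<close>

lemma bij_betw_exponent: "bij_betw (exponent n) (\<Pi>\<^sub>E i\<in>{1..n}. {0..n - i}) (box n 0)"
proof (rule bij_betw_byWitness[where f' = "\<lambda>m. restrict (Poly_Mapping.lookup m) {1..n}"])
  show "\<forall>\<alpha>\<in>\<Pi>\<^sub>E i\<in>{1..n}. {0..n - i}. restrict (Poly_Mapping.lookup (exponent n \<alpha>)) {1..n} = \<alpha>"
    by (auto simp: lookup_exponent fun_eq_iff PiE_def extensional_def)
  show "\<forall>m\<in>box n 0. exponent n (restrict (Poly_Mapping.lookup m) {1..n}) = m"
    by (auto intro!: poly_mapping_eqI simp: lookup_exponent box_def in_keys_iff subset_iff)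
  show "exponent n ` (\<Pi>\<^sub>E i\<in>{1..n}. {0..n - i}) \<subseteq> box n 0"
    using keys_exponent by (fastforce simp: box_def lookup_exponent PiE_iff)
  show "(\<lambda>m. restrict (Poly_Mapping.lookup m) {1..n}) ` box n 0 \<subseteq> (\<Pi>\<^sub>E i\<in>{1..n}. {0..n - i})"
    by (auto simp: box_def less_Suc_eq_le)
qed

lemma R_quot_monom_eq:
  assumes n: "Polynomial.degree f = n"
  shows "R_quot_monom f \<alpha> = to_R_quot f (Poly_Mapping.single (exponent n \<alpha>) 1)"
proof -
  interpret h: ring_hom_ring "mpoly_ring n" "R_quot f" "to_R_quot f"
    using to_R_quot_hom[of f] unfolding n .
  have carr: "Poly_Mapping.single m c \<in> carrier (mpoly_ring n)" if "Poly_Mapping.keys m \<subseteq> {1..n}" for m c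
    using that by (simp add: carrier_mpoly_ring supp_in_single)
  have pow: "to_R_quot f (mvar i) [^]\<^bsub>R_quot f\<^esub> k = to_R_quot f (Poly_Mapping.single (Poly_Mapping.single i k) 1)"
    if i: "i \<in> {1..n}" for i k
  proof (induction k)
    case 0
    then show ?case using h.hom_one by (simp add: mpoly_ring_simps)
  next
    case (Suc k)
    have "to_R_quot f (Poly_Mapping.single (Poly_Mapping.single i k) 1 \<otimes>\<^bsub>mpoly_ring n\<^esub> mvar i) =
        to_R_quot f (Poly_Mapping.single (Poly_Mapping.single i k) 1) \<otimes>\<^bsub>R_quot f\<^esub> to_R_quot f (mvar i)"
      unfolding mvar_def using i by (intro h.hom_mult carr) auto
    then show ?case
      using Suc by (simp add: mpoly_ring_simps mvar_def mult_single flip: single_add)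
  qed
  \<comment> \<open>Generalised to any list of indices; the bound on the keys is carried along
    because multiplicativity is only available on the carrier.\<close>
  have "foldr (\<lambda>i y. (to_R_quot f (mvar i) [^]\<^bsub>R_quot f\<^esub> \<alpha> i) \<otimes>\<^bsub>R_quot f\<^esub> y) is \<one>\<^bsub>R_quot f\<^esub> =
      to_R_quot f (Poly_Mapping.single (\<Sum>i\<leftarrow>is. Poly_Mapping.single i (\<alpha> i)) 1)
      \<and> Poly_Mapping.keys (\<Sum>i\<leftarrow>is. Poly_Mapping.single i (\<alpha> i)) \<subseteq> {1..n}"
    if "set is \<subseteq> {1..n}" for "is"
    using that
  proof (induction "is")
    case Nil
    then show ?case using h.hom_one by (simp add: mpoly_ring_simps)
  next
    case (Cons i "is")
    let ?s = "\<Sum>i\<leftarrow>is. Poly_Mapping.single i (\<alpha> i)" and ?i = "Poly_Mapping.single i (\<alpha> i)"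
    have keys: "Poly_Mapping.keys ?s \<subseteq> {1..n}" "Poly_Mapping.keys ?i \<subseteq> {1..n}"
      using Cons by auto
    then have "to_R_quot f (Poly_Mapping.single ?i 1 \<otimes>\<^bsub>mpoly_ring n\<^esub> Poly_Mapping.single ?s 1) =
        to_R_quot f (Poly_Mapping.single ?i 1) \<otimes>\<^bsub>R_quot f\<^esub> to_R_quot f (Poly_Mapping.single ?s 1)"
      by (intro h.hom_mult carr)
    moreover have "Poly_Mapping.keys (?i + ?s) \<subseteq> {1..n}"
      using keys Poly_Mapping.keys_add[of ?i ?s] by blast
    ultimately show ?case
      using Cons pow[of i "\<alpha> i"] by (simp add: mpoly_ring_simps mult_single)
  qed
  from this[of "[1..<Suc n]"] show ?thesis
    unfolding R_quot_monom_def n exponent_def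
    by (simp only: sum_list_distinct_conv_sum_set distinct_upt set_upt atLeastLessThanSuc_atLeastAtMost)
qed

section \<open>The quotient ring as a left module over \<open>T_quot f\<close>\<close>

lemma R_quot_module_simps:
  "carrier (R_quot_module f) = carrier (R_quot f)"
  "x \<oplus>\<^bsub>R_quot_module f\<^esub> y = x \<oplus>\<^bsub>R_quot f\<^esub> y"
  "\<zero>\<^bsub>R_quot_module f\<^esub> = \<zero>\<^bsub>R_quot f\<^esub>"
  by (simp_all add: R_quot_module_def)

lemma abelian_group_R_quot_module: "abelian_group (R_quot_module f)"
proof -
  interpret h: ring_hom_ring "mpoly_ring (Polynomial.degree f)" "R_quot f" "to_R_quot f"
    by (rule to_R_quot_hom)
  show ?thesis
    by (rule abelian_groupI)
      (auto simp: R_quot_module_simps h.S.a_ac intro!: bexI[of _ "\<ominus>\<^bsub>R_quot f\<^esub> _"] h.S.l_neg)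
qed

lemma to_R_quot_sum:
  fixes f :: "'a::ring_1 poly"
  assumes "finite F" "\<And>\<alpha>. \<alpha> \<in> F \<Longrightarrow> g \<alpha> \<in> carrier (mpoly_ring (Polynomial.degree f))"
  shows "(\<Oplus>\<^bsub>R_quot_module f\<^esub>\<alpha>\<in>F. to_R_quot f (g \<alpha>)) = to_R_quot f (sum g F)"
proof -
  let ?P = "mpoly_ring (Polynomial.degree f) :: 'a mpoly ring"
  interpret h: ring_hom_ring ?P "R_quot f" "to_R_quot f"
    by (rule to_R_quot_hom)
  interpret M: abelian_group "R_quot_module f"
    by (rule abelian_group_R_quot_module)
  show ?thesis
    using assms
  proof (induction F rule: finite_induct)
    case empty
    then show ?case using h.hom_zero by (simp add: mpoly_ring_simps R_quot_module_simps)
  next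
    case (insert \<alpha> F)
    have "sum g F \<in> carrier ?P"
      unfolding carrier_mpoly_ring
      by (intro sum_in_set supp_in_0 supp_in_add) (use insert.prems in \<open>auto simp: carrier_mpoly_ring\<close>)
    then have "to_R_quot f (g \<alpha> \<oplus>\<^bsub>?P\<^esub> sum g F) =
        to_R_quot f (g \<alpha>) \<oplus>\<^bsub>R_quot f\<^esub> to_R_quot f (sum g F)"
      using insert.prems by (intro h.hom_add) auto
    then show ?case
      using insert by (simp add: mpoly_ring_simps R_quot_module_simps M.finsum_insert Pi_iff)
  qed
qed

lemma T_quot_surj:
  assumes "t \<in> carrier (T_quot f)"
  obtains r where "t = L_ideal f +>\<^bsub>ring_of_type_algebra\<^esub> r"
  using assms by (auto simp: T_quot_def FactRing_def A_RCOSETS_def')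

lemma T_quot_zero: "L_ideal f +>\<^bsub>ring_of_type_algebra\<^esub> r = \<zero>\<^bsub>T_quot f\<^esub> \<longleftrightarrow> r \<in> L_ideal f"
proof -
  interpret L: ideal "L_ideal f" ring_of_type_algebra by (rule L_ideal_ideal)
  show ?thesis
    using L.a_rcos_const[of r] L.a_rcos_self[of r]
    by (auto simp: T_quot_def FactRing_def ring_of_type_algebra_def)
qed

lemma left_module_R_quot:
  fixes f :: "'a::ring_1 poly"
  shows "left_module (T_quot f) (R_quot_module f)"
proof -
  let ?A = "ring_of_type_algebra :: 'a ring"
  let ?coset = "\<lambda>r. L_ideal f +>\<^bsub>?A\<^esub> r"
  interpret A: ring ?A by (rule ring_of_type_algebra_ring)
  interpret L: ideal "L_ideal f" ?A by (rule L_ideal_ideal)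
  interpret T: ring "T_quot f" unfolding T_quot_def by (rule L.quotient_is_ring)
  interpret h: ring_hom_ring ?A "R_quot f" "\<lambda>r. to_R_quot f (mconst r)"
    by (rule to_R_quot_mconst_hom)
  interpret \<pi>: ring_hom_ring ?A "T_quot f" "?coset"
    using L.rcos_ring_hom unfolding T_quot_def by (intro ring_hom_ringI2 A.ring_axioms L.quotient_is_ring)
  have [simp]: "r \<in> carrier ?A" for r by (simp add: ring_of_type_algebra_def)
  have [simp]: "?coset r \<odot>\<^bsub>R_quot_module f\<^esub> y = to_R_quot f (mconst r) \<otimes>\<^bsub>R_quot f\<^esub> y" for r y
    by (rule R_quot_module_smult)
  \<comment> \<open>Oriented to merge cosets, against the homomorphism laws, so that a sum or
    product of cosets acts as one coset and the module axioms become ring laws in R_f.\<close>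
  have [simp]: "?coset r \<oplus>\<^bsub>T_quot f\<^esub> ?coset s = ?coset (r \<oplus>\<^bsub>?A\<^esub> s)"
    "?coset r \<otimes>\<^bsub>T_quot f\<^esub> ?coset s = ?coset (r \<otimes>\<^bsub>?A\<^esub> s)" "\<one>\<^bsub>T_quot f\<^esub> = ?coset \<one>\<^bsub>?A\<^esub>" for r s
    by simp_all
  interpret M: abelian_group "R_quot_module f"
    by (rule abelian_group_R_quot_module)
  show ?thesis
  proof unfold_locales
    fix t x assume t: "t \<in> carrier (T_quot f)" and x: "x \<in> carrier (R_quot_module f)"
    obtain r where [simp]: "t = ?coset r" using T_quot_surj[OF t] .
    show "t \<odot>\<^bsub>R_quot_module f\<^esub> x \<in> carrier (R_quot_module f)"
      using x by (simp add: R_quot_module_simps)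
    show "t \<odot>\<^bsub>R_quot_module f\<^esub> (x \<oplus>\<^bsub>R_quot_module f\<^esub> y) =
        t \<odot>\<^bsub>R_quot_module f\<^esub> x \<oplus>\<^bsub>R_quot_module f\<^esub> t \<odot>\<^bsub>R_quot_module f\<^esub> y"
      if "y \<in> carrier (R_quot_module f)" for y
      using x that by (simp add: R_quot_module_simps h.S.r_distr)
    fix u assume u: "u \<in> carrier (T_quot f)"
    obtain s where [simp]: "u = ?coset s" using T_quot_surj[OF u] .
    show "(t \<oplus>\<^bsub>T_quot f\<^esub> u) \<odot>\<^bsub>R_quot_module f\<^esub> x =
        t \<odot>\<^bsub>R_quot_module f\<^esub> x \<oplus>\<^bsub>R_quot_module f\<^esub> u \<odot>\<^bsub>R_quot_module f\<^esub> x"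
      using x by (simp add: R_quot_module_simps h.S.l_distr del: \<pi>.hom_add)
    show "(t \<otimes>\<^bsub>T_quot f\<^esub> u) \<odot>\<^bsub>R_quot_module f\<^esub> x =
        t \<odot>\<^bsub>R_quot_module f\<^esub> (u \<odot>\<^bsub>R_quot_module f\<^esub> x)"
      using x by (simp add: R_quot_module_simps h.S.m_assoc del: \<pi>.hom_mult)
  next
    fix x assume "x \<in> carrier (R_quot_module f)"
    then show "\<one>\<^bsub>T_quot f\<^esub> \<odot>\<^bsub>R_quot_module f\<^esub> x = x"
      by (simp add: R_quot_module_simps del: \<pi>.hom_one)
  qed
qed


section \<open>Coefficients of elements of \<open>I_ideal f\<close>\<close>

text \<open>The coefficients of f from the top, in the form that \<open>hcoef\<close> expects. The
  values 1 at 0 and 0 beyond n commute with everything, so centrality modulo L_f holds at every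
  index.\<close>

definition signed_coeffs :: "nat \<Rightarrow> (nat \<Rightarrow> 'a::ring_1) \<Rightarrow> nat \<Rightarrow> 'a" where
  "signed_coeffs n a i = (if i = 0 then 1 else if i \<le> n then (- 1) ^ i * a i else 0)"

lemma signed_coeffs_sign:
  "i \<in> {1..n} \<Longrightarrow> (- 1) ^ i * signed_coeffs n a i = a i"
  by (cases "even i") (simp_all add: signed_coeffs_def)

context
  fixes f :: "'a::ring_1 poly" and n :: nat and a :: "nat \<Rightarrow> 'a"
  assumes degree: "Polynomial.degree f = n"
    and vcoeff: "\<And>i. i \<in> {1..n} \<Longrightarrow> vcoeff f i = a i"
begin

lemma I_ideal_eq:
  "I_ideal f = genideal (mpoly_ring n)
    ((\<lambda>i. elem_sym n i - mconst ((- 1) ^ i * signed_coeffs n a i)) ` {1..n})"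
proof -
  have "(\<lambda>i. elem_sym n i - mconst (vcoeff f i)) ` {1..n} =
      (\<lambda>i. elem_sym n i - mconst ((- 1) ^ i * signed_coeffs n a i)) ` {1..n}"
    by (intro image_cong) (simp_all only: vcoeff signed_coeffs_sign)
  then show ?thesis
    unfolding I_ideal_def Let_def degree by simp
qed

lemma
  shows I_ideal_0: "0 \<in> I_ideal f"
    and I_ideal_add: "x \<in> I_ideal f \<Longrightarrow> y \<in> I_ideal f \<Longrightarrow> x + y \<in> I_ideal f"
    and I_ideal_diff: "x \<in> I_ideal f \<Longrightarrow> y \<in> I_ideal f \<Longrightarrow> x - y \<in> I_ideal f"
    and I_ideal_l_mult: "x \<in> I_ideal f \<Longrightarrow> q \<in> carrier (mpoly_ring n) \<Longrightarrow> q * x \<in> I_ideal f"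
proof -
  interpret P: ring "mpoly_ring n :: 'a mpoly ring" by (rule mpoly_ring_ring)
  interpret I: ideal "I_ideal f" "mpoly_ring n"
    using I_ideal_ideal[of f] unfolding degree .
  show "0 \<in> I_ideal f"
    using additive_subgroup.zero_closed[OF I.additive_subgroup_axioms] unfolding mpoly_ring_simps .
  show "x + y \<in> I_ideal f" if "x \<in> I_ideal f" "y \<in> I_ideal f"
    using I.a_closed[OF that] by (simp add: mpoly_ring_simps)
  show "x - y \<in> I_ideal f" if "x \<in> I_ideal f" "y \<in> I_ideal f"
    using I.a_closed[OF that(1) I.a_inv_closed[OF that(2)]]
    unfolding minus_mpoly_ring[OF I.a_Hcarr[OF that(1)] I.a_Hcarr[OF that(2)], symmetric] a_minus_def .
  show "q * x \<in> I_ideal f" if "x \<in> I_ideal f" "q \<in> carrier (mpoly_ring n)"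
    using I.I_l_closed[OF that] by (simp add: mpoly_ring_simps)
qed

text \<open>The equivalence of relations and remainders for \<open>S\<close> = I_f, read from the
  generators to the remainders.\<close>

lemma remainder_in_I_ideal:
  assumes "k \<in> {1..n}"
  shows "hcoef (signed_coeffs n a) k (Suc (n - k)) \<in> I_ideal f"
proof -
  interpret P: ring "mpoly_ring n :: 'a mpoly ring" by (rule mpoly_ring_ring)
  have "elem_sym n i - mconst ((- 1) ^ i * signed_coeffs n a i) \<in> I_ideal f" if "i \<in> {1..n}" for i
    unfolding I_ideal_eq by (intro subsetD[OF P.genideal_self[OF I_generators_carrier]] imageI that)
  moreover have mvar: "mvar k \<in> carrier (mpoly_ring n)" if "k \<in> {1..n}" for k
    using that by (simp add: mvar_def carrier_mpoly_ring supp_in_single)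
  have "(\<forall>i\<in>{1..n}. elem_sym n i - mconst ((- 1) ^ i * signed_coeffs n a i) \<in> I_ideal f) \<longleftrightarrow>
      (\<forall>k\<in>{1..n}. hcoef (signed_coeffs n a) k (Suc (n - k)) \<in> I_ideal f)"
    by (intro elem_sym_relations_iff_remainders I_ideal_0 I_ideal_diff I_ideal_l_mult mvar)
      (simp_all add: signed_coeffs_def)
  ultimately show ?thesis using assms by blast
qed

lemma central_modulo_L_ideal: "central_modulo (L_ideal f) (signed_coeffs n a)"
proof -
  let ?A = "ring_of_type_algebra :: 'a ring"
  interpret A: ring ?A by (rule ring_of_type_algebra_ring)
  interpret L: ideal "L_ideal f" ?A by (rule L_ideal_ideal)
  have A: "carrier ?A = UNIV" "\<zero>\<^bsub>?A\<^esub> = 0" "x \<oplus>\<^bsub>?A\<^esub> y = x + y" "x \<otimes>\<^bsub>?A\<^esub> y = x * y" for x y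
    by (simp_all add: ring_of_type_algebra_def)
  have l_mult: "r * x \<in> L_ideal f" and r_mult: "x * r \<in> L_ideal f" if "x \<in> L_ideal f" for x r
    using L.I_l_closed[OF that, of r] L.I_r_closed[OF that, of r] by (simp_all add: A)
  have zero: "0 \<in> L_ideal f"
    using L.zero_closed by (simp add: A)
  have add: "x + y \<in> L_ideal f" if "x \<in> L_ideal f" "y \<in> L_ideal f" for x y
    using L.a_closed[OF that] by (simp add: A)
  have comm: "r * a i - a i * r \<in> L_ideal f" if "i \<in> {1..n}" for r i
  proof -
    have "r * vcoeff f i - vcoeff f i * r \<in>
        {x * vcoeff f i - vcoeff f i * x | x i. i \<in> {1..Polynomial.degree f}}"
      using that degree by blast
    then have "r * vcoeff f i - vcoeff f i * r \<in> L_ideal f"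
      unfolding L_ideal_def by (rule subsetD[OF A.genideal_self, rotated]) (simp add: A)
    then show ?thesis by (simp add: vcoeff[OF that])
  qed
  show ?thesis
  proof
    show "x - y \<in> L_ideal f" if "x \<in> L_ideal f" "y \<in> L_ideal f" for x y
      using add[OF that(1) l_mult[OF that(2), of "- 1"]] by simp
    show "r * signed_coeffs n a i - signed_coeffs n a i * r \<in> L_ideal f" for r i
    proof (cases "i \<in> {1..n}")
      case True
      have "r * ((- 1) ^ i * c) - (- 1) ^ i * c * r = (- 1) ^ i * (r * c - c * r)" for c :: 'a
        by (cases "even i") simp_all
      then show ?thesis
        using True l_mult[OF comm[OF True]] by (simp add: signed_coeffs_def)
    qed (auto simp: signed_coeffs_def zero)
  qed (simp_all add: zero l_mult r_mult signed_coeffs_def)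
qed

section \<open>The ideal I_f modulo L_f and the monomial basis\<close>

interpretation central_modulo "L_ideal f" "signed_coeffs n a" n
  by (rule central_modulo_L_ideal)

text \<open>The same equivalence for \<open>S\<close> = \<open>rem_ideal n\<close>, now read from
  the remainders to the generators.\<close>

lemma I_ideal_subset_rem_ideal: "I_ideal f \<subseteq> rem_ideal n"
proof -
  let ?P = "mpoly_ring n :: 'a mpoly ring"
  interpret P: ring ?P by (rule mpoly_ring_ring)
  have inv: "\<ominus>\<^bsub>?P\<^esub> x = - x" if "x \<in> carrier ?P" for x
    using minus_mpoly_ring[OF P.zero_closed that] that by (simp add: mpoly_ring_simps P.minus_eq)
  \<comment> \<open>\<open>rem_ideal n\<close> may contain polynomials in further variables, so it
    is cut down to the polynomial ring.\<close>
  have "subgroup (rem_ideal n \<inter> carrier ?P) (add_monoid ?P)"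
  proof (rule subgroup.intro)
    show "inv\<^bsub>add_monoid ?P\<^esub> x \<in> rem_ideal n \<inter> carrier ?P" if "x \<in> rem_ideal n \<inter> carrier ?P" for x
    proof -
      have "inv\<^bsub>add_monoid ?P\<^esub> x = - x"
        using inv that by (simp add: a_inv_def)
      moreover have "- x \<in> rem_ideal n"
        using rem_ideal_diff[OF rem_ideal_0, of x] that by simp
      moreover have "- x \<in> carrier ?P"
        using P.a_inv_closed[of x] inv that by auto
      ultimately show ?thesis by simp
    qed
  qed (use P.a_closed P.add.one_closed in \<open>auto simp: mpoly_ring_simps rem_ideal_add rem_ideal_0\<close>)
  then have "ideal (rem_ideal n \<inter> carrier ?P) ?P"
    by (rule idealI[OF mpoly_ring_ring])
      (use P.m_closed in \<open>auto simp: mpoly_ring_simps rem_ideal_l_mult rem_ideal_r_mult\<close>)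
  moreover have "(\<forall>i\<in>{1..n}. elem_sym n i - mconst ((- 1) ^ i * signed_coeffs n a i) \<in> rem_ideal n) \<longleftrightarrow>
      (\<forall>k\<in>{1..n}. remainder k \<in> rem_ideal n)"
    by (intro elem_sym_relations_iff_remainders rem_ideal_0 rem_ideal_diff rem_ideal_l_mult) (simp_all add: signed_coeffs_def)
  then have "elem_sym n i - mconst ((- 1) ^ i * signed_coeffs n a i) \<in> rem_ideal n" if "i \<in> {1..n}" for i
    using remainder_in_rem_ideal that by blast
  ultimately have "I_ideal f \<subseteq> rem_ideal n \<inter> carrier ?P"
    unfolding I_ideal_eq using I_generators_carrier[of n "\<lambda>i. (- 1) ^ i * signed_coeffs n a i"]
    by (intro P.genideal_minimal) auto
  then show ?thesis by blast
qed

text \<open>The common source of both claims: applied to a constant it gives M_f \<subseteq> L_f,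
  applied to a lifted linear relation it gives independence.\<close>

lemma box_I_ideal_coeffs_in:
  assumes "p \<in> I_ideal f" "p \<in> supp_in (box n 0)"
  shows "p \<in> coeffs_in (L_ideal f)"
proof (rule reduced_in_rem_ideal_coeffs_in)
  show "p \<in> rem_ideal n" using assms I_ideal_subset_rem_ideal by blast
  show "p \<in> supp_in {m. Poly_Mapping.lookup m j < Suc (n - j)}" if "j \<in> {1..n}" for j
    using assms(2) by (rule supp_in_mono) (use that in \<open>auto simp: box_def\<close>)
qed simp

lemma M_ideal_subset_L_ideal: "M_ideal f \<subseteq> L_ideal f"
proof
  fix r assume "r \<in> M_ideal f"
  then have "mconst r \<in> I_ideal f"
    using to_R_quot_eq_zero[OF mconst_carrier, of f r] by (simp add: M_ideal_def a_kernel_def')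
  moreover have "mconst r \<in> supp_in (box n 0)"
    by (simp add: mconst_def supp_in_single box_def)
  ultimately have "mconst r \<in> coeffs_in (L_ideal f)"
    by (rule box_I_ideal_coeffs_in)
  then show "r \<in> L_ideal f"
    unfolding coeffs_in_def mconst_def by (metis (mono_tags, lifting) lookup_single_eq mem_Collect_eq)
qed

text \<open>Choosing representatives \<open>r\<close> lifts a combination over T_f to a single
  polynomial, so that spanning and independence become questions about reduced polynomials modulo
  I_f.\<close>

lemma linear_combination_eq:
  assumes "finite F" "\<And>\<alpha>. \<alpha> \<in> F \<Longrightarrow> c \<alpha> = L_ideal f +>\<^bsub>ring_of_type_algebra\<^esub> r \<alpha>"
  shows "(\<Oplus>\<^bsub>R_quot_module f\<^esub>\<alpha>\<in>F. c \<alpha> \<odot>\<^bsub>R_quot_module f\<^esub> R_quot_monom f \<alpha>) =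
    to_R_quot f (\<Sum>\<alpha>\<in>F. Poly_Mapping.single (exponent n \<alpha>) (r \<alpha>))"
proof -
  interpret h: ring_hom_ring "mpoly_ring n" "R_quot f" "to_R_quot f"
    using to_R_quot_hom[of f] unfolding degree .
  interpret M: abelian_group "R_quot_module f"
    by (rule abelian_group_R_quot_module)
  have "c \<alpha> \<odot>\<^bsub>R_quot_module f\<^esub> R_quot_monom f \<alpha> =
      to_R_quot f (Poly_Mapping.single (exponent n \<alpha>) (r \<alpha>))" if "\<alpha> \<in> F" for \<alpha>
    unfolding assms(2)[OF that] R_quot_module_smult R_quot_monom_eq[OF degree]
      h.hom_mult[OF mconst_carrier single_exponent_carrier, symmetric]
    by (simp add: mpoly_ring_simps mconst_def mult_single)
  then have "(\<Oplus>\<^bsub>R_quot_module f\<^esub>\<alpha>\<in>F. c \<alpha> \<odot>\<^bsub>R_quot_module f\<^esub> R_quot_monom f \<alpha>) =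
      (\<Oplus>\<^bsub>R_quot_module f\<^esub>\<alpha>\<in>F. to_R_quot f (Poly_Mapping.single (exponent n \<alpha>) (r \<alpha>)))"
    by (intro M.finsum_cong') (auto simp: R_quot_module_simps single_exponent_carrier)
  also have "\<dots> = to_R_quot f (\<Sum>\<alpha>\<in>F. Poly_Mapping.single (exponent n \<alpha>) (r \<alpha>))"
    using assms(1) degree by (intro to_R_quot_sum) (simp_all add: single_exponent_carrier)
  finally show ?thesis .
qed

lemma R_quot_monom_spans:
  assumes "x \<in> carrier (R_quot_module f)"
  shows "\<exists>F c. finite F \<and> F \<subseteq> (\<Pi>\<^sub>E i\<in>{1..n}. {0..n - i}) \<and> c \<in> F \<rightarrow> carrier (T_quot f) \<and>
    x = (\<Oplus>\<^bsub>R_quot_module f\<^esub>\<alpha>\<in>F. c \<alpha> \<odot>\<^bsub>R_quot_module f\<^esub> R_quot_monom f \<alpha>)"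
proof -
  let ?A = "\<Pi>\<^sub>E i\<in>{1..n}. {0..n - i}"
  obtain p where p: "p \<in> carrier (mpoly_ring n)" "x = to_R_quot f p"
    using assms to_R_quot_surj[of x f] unfolding R_quot_module_simps degree by blast
  obtain r where r: "r \<in> supp_in (box n 0)" "p - r \<in> I_ideal f"
    using reduce_modulo_remainders[of "signed_coeffs n a" "I_ideal f" n p]
      p I_ideal_0 I_ideal_add I_ideal_l_mult remainder_in_I_ideal b0
    unfolding carrier_mpoly_ring by blast
  \<comment> \<open>The classes of the coefficients of the reduced \<open>r\<close>; as the index
    set is finite, the combination can run over all of it.\<close>
  define c where "c \<alpha> = L_ideal f +>\<^bsub>ring_of_type_algebra\<^esub> Poly_Mapping.lookup r (exponent n \<alpha>)" for \<alpha>
  have fin: "finite ?A" by (intro finite_PiE) auto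
  have "r \<in> carrier (mpoly_ring n)"
    using r(1) unfolding carrier_mpoly_ring by (rule supp_in_mono) (auto simp: box_def)
  then have "x = to_R_quot f r"
    using p r(2) degree by (simp add: to_R_quot_cong)
  also have "r = (\<Sum>m\<in>box n 0. Poly_Mapping.single m (Poly_Mapping.lookup r m))"
    using r(1) bij_betw_finite[OF bij_betw_exponent[of n]] fin
    by (subst poly_mapping_sum_single[of r, symmetric], intro sum.mono_neutral_left)
      (auto simp: supp_in_def in_keys_iff)
  also have "\<dots> = (\<Sum>\<alpha>\<in>?A. Poly_Mapping.single (exponent n \<alpha>) (Poly_Mapping.lookup r (exponent n \<alpha>)))"
    by (rule sum.reindex_bij_betw[OF bij_betw_exponent, symmetric])
  also have "to_R_quot f \<dots> = (\<Oplus>\<^bsub>R_quot_module f\<^esub>\<alpha>\<in>?A. c \<alpha> \<odot>\<^bsub>R_quot_module f\<^esub> R_quot_monom f \<alpha>)"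
    using fin by (intro linear_combination_eq[symmetric]) (simp_all add: c_def)
  moreover have "c \<alpha> \<in> carrier (T_quot f)" for \<alpha>
    by (auto simp: c_def T_quot_def FactRing_def A_RCOSETS_def' ring_of_type_algebra_def)
  ultimately show ?thesis
    using fin by blast
qed

lemma R_quot_monom_independent:
  assumes F: "finite F" "F \<subseteq> (\<Pi>\<^sub>E i\<in>{1..n}. {0..n - i})" and c: "c \<in> F \<rightarrow> carrier (T_quot f)"
    and eq: "(\<Oplus>\<^bsub>R_quot_module f\<^esub>\<alpha>\<in>F. c \<alpha> \<odot>\<^bsub>R_quot_module f\<^esub> R_quot_monom f \<alpha>) = \<zero>\<^bsub>R_quot_module f\<^esub>"
    and \<alpha>: "\<alpha> \<in> F"
  shows "c \<alpha> = \<zero>\<^bsub>T_quot f\<^esub>"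
proof -
  have "\<exists>r. c \<beta> = L_ideal f +>\<^bsub>ring_of_type_algebra\<^esub> r" if "\<beta> \<in> F" for \<beta>
    using c that T_quot_surj[of "c \<beta>" f] by blast
  then obtain r where r: "\<And>\<beta>. \<beta> \<in> F \<Longrightarrow> c \<beta> = L_ideal f +>\<^bsub>ring_of_type_algebra\<^esub> r \<beta>"
    by metis
  define p where "p = (\<Sum>\<beta>\<in>F. Poly_Mapping.single (exponent n \<beta>) (r \<beta>))"
  have p_box: "p \<in> supp_in (box n 0)"
    unfolding p_def
    using bij_betw_apply[OF bij_betw_exponent[of n] subsetD[OF F(2)]]
    by (intro sum_in_set supp_in_0 supp_in_add supp_in_single)
  then have "p \<in> carrier (mpoly_ring n)"
    unfolding carrier_mpoly_ring by (rule supp_in_mono) (auto simp: box_def)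
  moreover have "to_R_quot f p = \<zero>\<^bsub>R_quot f\<^esub>"
    using eq linear_combination_eq[OF F(1) r] unfolding p_def R_quot_module_simps by simp
  ultimately have "p \<in> I_ideal f"
    using to_R_quot_eq_zero[of p f] degree by simp
  then have "p \<in> coeffs_in (L_ideal f)"
    using p_box by (rule box_I_ideal_coeffs_in)
  \<comment> \<open>No two terms of \<open>p\<close> collide, by injectivity of
    \<open>exponent n\<close> on the index set.\<close>
  moreover have "Poly_Mapping.lookup p (exponent n \<alpha>) = r \<alpha>"
  proof -
    have "exponent n \<beta> = exponent n \<alpha> \<longleftrightarrow> \<beta> = \<alpha>" if "\<beta> \<in> F" for \<beta>
      using that \<alpha> F(2) bij_betw_imp_inj_on[OF bij_betw_exponent[of n]] by (meson inj_on_eq_iff subsetD)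
    then have "Poly_Mapping.lookup p (exponent n \<alpha>) = (\<Sum>\<beta>\<in>F. if \<beta> = \<alpha> then r \<beta> else 0)"
      unfolding p_def lookup_sum by (intro sum.cong) (auto simp: lookup_single when_def)
    then show ?thesis using F(1) \<alpha> by simp
  qed
  ultimately have "r \<alpha> \<in> L_ideal f"
    by (metis (mono_tags, lifting) coeffs_in_def mem_Collect_eq)
  then show ?thesis
    using r[OF \<alpha>] T_quot_zero by metis
qed

lemma free_left_module_R_quot:
  "free_left_module_on (T_quot f) (R_quot_module f) (\<Pi>\<^sub>E i\<in>{1..n}. {0..n - i}) (R_quot_monom f)"
proof -
  interpret h: ring_hom_ring "mpoly_ring n" "R_quot f" "to_R_quot f"
    using to_R_quot_hom[of f] unfolding degree .
  have "R_quot_monom f \<alpha> \<in> carrier (R_quot_module f)" for \<alpha>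
    unfolding R_quot_monom_eq[OF degree] R_quot_module_simps
    by (intro h.hom_closed single_exponent_carrier)
  then have "R_quot_monom f \<in> A \<rightarrow> carrier (R_quot_module f)" for A
    by (intro Pi_I)
  with left_module_R_quot R_quot_monom_spans show ?thesis
    unfolding free_left_module_on_def
  proof (intro conjI ballI allI impI)
    fix F c \<alpha>
    assume "finite F \<and> F \<subseteq> (\<Pi>\<^sub>E i\<in>{1..n}. {0..n - i}) \<and> c \<in> F \<rightarrow> carrier (T_quot f) \<and>
      (\<Oplus>\<^bsub>R_quot_module f\<^esub>\<alpha>\<in>F. c \<alpha> \<odot>\<^bsub>R_quot_module f\<^esub> R_quot_monom f \<alpha>) = \<zero>\<^bsub>R_quot_module f\<^esub>"
      and "\<alpha> \<in> F"
    then show "c \<alpha> = \<zero>\<^bsub>T_quot f\<^esub>"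
      by (elim conjE) (rule R_quot_monom_independent)
  qed
qed

end

theorem theorem3p2:
  fixes f :: "'a::ring_1 poly" and n :: nat and a :: "nat \<Rightarrow> 'a"
  assumes "n \<ge> 1"
    and "f = Polynomial.monom 1 n + (\<Sum>i=1..n. Polynomial.monom ((- 1) ^ i * a i) (n - i))"
  shows "L_ideal f = M_ideal f \<and>
         free_left_module_on (T_quot f) (R_quot_module f)
           (\<Pi>\<^sub>E i\<in>{1..n}. {0..n - i}) (R_quot_monom f)"
proof -
  note degree = degree_signed_monic[OF assms(2)] and vcoeff = vcoeff_eq[OF assms(2)]
  show ?thesis
    by (intro conjI antisym L_ideal_subset_M_ideal M_ideal_subset_L_ideal[OF degree vcoeff]
        free_left_module_R_quot[OF degree vcoeff])
qed

end
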